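(* Let $(p_k)_{k\ge 0}$ be a probability distribution on $\mathbb N=\{0,1,2,\dots\}$ with $p_0>0$, $p_0+p_1<1$, $\sum_{k\ge0}k\,p_k<1$, and $R(v):=\sum_{k\ge2}p_kv^k<\infty$ for all $v\geq 0$. For $n\in\mathbb N$, $b=e^{\beta}>1$ and $x\in\{1,2\}$, let $\Xi_n^x$ be the partition function of the interacting tree model defined in the context. Then $\Xi_n^x$ is an increasing function of $n$, and there exists $b_c=b_c((p_k)_k)>1$ such that $\Xi_n^x$ converges to a finite limit $\Xi_\infty^x$ as $n\to\infty$ if and only if $b\le b_c$; here $b_c$ is the first component of the critical pair $(b_c,v_c)$ defined in the context. Moreover, if $b=b_c$, then as $n\to\infty$ $$\Xi_n^1-\Xi_\infty^1=-\frac{a}{n\,g_2}+\mathcal O\!\left(\frac{\log n}{n^2}\right),\qquad \Xi_n^2-\Xi_\infty^2=-\frac{1}{n\,g_2}+\mathcal O\!\left(\frac{\log n}{n^2}\right),$$ where $$a=\frac{1}{(b_c-1)(1-p_1)+1},\qquad g_2=\frac{R''(v_c)}{2}\,\frac{\bigl[(b_c-1)(1-p_1)+1\bigr]^2}{(b_c-1)(1-p_1)^2+1}.$$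
   Context: Trees. $\mathcal T_n$ is the set of planar rooted trees in which the root has distance $0$, and the nodes $i\in\omega$ are those at distance $|i|\le n$ from the root; each node $i\in\omega$ has a number of offspring $X_i=X_i(\omega)\in\mathbb N$. The offspring of nodes at distance exactly $n$ (located at distance $n+1$) are called external nodes; they carry no information other than their number and are not counted among the nodes $i\in\omega$. The root is denoted $0$, and $a(i)$ is the parent of node $i$. For the root, $X_{a(0)}:=x$ is a prescribed boundary condition. Free measure: $\mathbb P^{GW}(\omega)=\prod_{i\in\omega}p_{X_i(\omega)}$ for $\omega\in\mathcal T_n$. Interaction: $\varphi(X,Y)=-1_{X\ge2}1_{Y\ge2}$ and $H_n^x(\omega)=\sum_{i\in\omega}\varphi(X_{a(i)},X_i)$ (the root contributes $\varphi(x,X_0)$). Partition function: $\Xi_n^x=\sum_{\omega\in\mathcal T_n}\mathbb P^{GW}(\omega)e^{-\beta H_n^x(\omega)}$, with $b=e^\beta$. Critical pair: $(b_c,v_c)$ is the solution $(b,v)$ with $v\ge1$ of the system $$v=\frac{p_0}{1-p_1}+\frac{(1-p_1)b+p_1}{1-p_1}R(v),\qquad 1=\frac{(1-p_1)b+p_1}{1-p_1}R'(v).$$ *)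

theory Defs
  imports "HOL-Probability.Probability" "HOL-Library.Landau_Symbols"
begin

datatype plane_tree = Node (children: "plane_tree list")

text \<open>
  Vertices are addressed by Ulam--Harris words: \<open>[]\<close> is the root, and \<open>i @ [j]\<close> is the
  \<open>j\<close>-th child (counted from \<open>0\<close>) of \<open>i\<close>.  So the distance of \<open>i\<close> from the root is
  \<open>length i\<close>, and the parent of \<open>i \<noteq> []\<close> is \<open>butlast i\<close>.
\<close>

primrec is_vertex :: "nat list \<Rightarrow> plane_tree \<Rightarrow> bool" where
  "is_vertex [] \<omega> \<longleftrightarrow> True"
| "is_vertex (j # i) \<omega> \<longleftrightarrow> j < length (children \<omega>) \<and> is_vertex i (children \<omega> ! j)"

primrec offspring :: "nat list \<Rightarrow> plane_tree \<Rightarrow> nat" where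
  "offspring [] \<omega> = length (children \<omega>)"
| "offspring (j # i) \<omega> = offspring i (children \<omega> ! j)"

definition vertices :: "plane_tree \<Rightarrow> nat list set" where
  "vertices \<omega> = {i. is_vertex i \<omega>}"

lemma finite_vertices: "finite (vertices \<omega>)"
proof (induction \<omega>)
  case (Node ts)
  have "vertices (Node ts) \<subseteq> insert [] (\<Union>j<length ts. (#) j ` vertices (ts ! j))"
  proof
    fix i assume "i \<in> vertices (Node ts)"
    then show "i \<in> insert [] (\<Union>j<length ts. (#) j ` vertices (ts ! j))"
      by (cases i) (auto simp: vertices_def)
  qed
  moreover have "finite (insert [] (\<Union>j<length ts. (#) j ` vertices (ts ! j)))"
    using Node by simp
  ultimately show ?case
    by (rule finite_subset)
qed

text \<open>
  The vertices at distance \<open>n + 1\<close> of a tree in \<open>plane_trees n\<close> are its external nodes.  They are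
  necessarily childless, so that only their number is recorded, and they are excluded from
  \<open>nodes n\<close>.
\<close>

definition plane_trees :: "nat \<Rightarrow> plane_tree set" where
  "plane_trees n = {\<omega>. \<forall>i\<in>vertices \<omega>. length i \<le> n + 1}"

definition nodes :: "nat \<Rightarrow> plane_tree \<Rightarrow> nat list set" where
  "nodes n \<omega> = {i \<in> vertices \<omega>. length i \<le> n}"

definition parent_offspring :: "nat \<Rightarrow> plane_tree \<Rightarrow> nat list \<Rightarrow> nat" where
  "parent_offspring x \<omega> i = (if i = [] then x else offspring (butlast i) \<omega>)"

definition gw_prob :: "nat pmf \<Rightarrow> nat \<Rightarrow> plane_tree \<Rightarrow> real" where
  "gw_prob p n \<omega> = (\<Prod>i\<in>nodes n \<omega>. pmf p (offspring i \<omega>))"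

definition interaction :: "nat \<Rightarrow> nat \<Rightarrow> real" where
  "interaction X Y = - (of_bool (X \<ge> 2) * of_bool (Y \<ge> 2))"

definition hamiltonian :: "nat \<Rightarrow> nat \<Rightarrow> plane_tree \<Rightarrow> real" where
  "hamiltonian n x \<omega> =
     (\<Sum>i\<in>nodes n \<omega>. interaction (parent_offspring x \<omega> i) (offspring i \<omega>))"

definition tree_weight :: "nat pmf \<Rightarrow> real \<Rightarrow> nat \<Rightarrow> nat \<Rightarrow> plane_tree \<Rightarrow> real" where
  "tree_weight p \<beta> x n \<omega> = gw_prob p n \<omega> * exp (- \<beta> * hamiltonian n x \<omega>)"

definition \<Xi> :: "nat pmf \<Rightarrow> real \<Rightarrow> nat \<Rightarrow> nat \<Rightarrow> real" where
  "\<Xi> p \<beta> x n = (\<Sum>\<^sub>\<infinity>\<omega>\<in>plane_trees n. tree_weight p \<beta> x n \<omega>)"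

definition tail_gf :: "nat pmf \<Rightarrow> real \<Rightarrow> real" where
  "tail_gf p v = (\<Sum>\<^sub>\<infinity>k\<in>{2..}. pmf p k * v ^ k)"

definition is_critical_pair :: "nat pmf \<Rightarrow> real \<Rightarrow> real \<Rightarrow> bool" where
  "is_critical_pair p b v \<longleftrightarrow>
     v \<ge> 1 \<and>
     v = pmf p 0 / (1 - pmf p 1)
         + ((1 - pmf p 1) * b + pmf p 1) / (1 - pmf p 1) * tail_gf p v \<and>
     1 = ((1 - pmf p 1) * b + pmf p 1) / (1 - pmf p 1) * deriv (tail_gf p) v"

end

theory Submission
  imports Defs
begin

text \<open>
  Cutting a tree at its root gives the recursion \<open>u (n + 1) = p0 + p1 * u n + R (v n)\<close>,
  \<open>v (n + 1) = p0 + p1 * u n + b * R (v n)\<close> for \<open>u n = \<Xi> p \<beta> 1 n\<close>, \<open>v n = \<Xi> p \<beta> 2 n\<close>, where \<open>R\<close> is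
  \<open>tail_gf p\<close>, started one step earlier from \<open>(1, 1)\<close>.  The orbit increases, so it converges iff the map has a fixed point
  with \<open>v \<ge> 1\<close>; eliminating \<open>u\<close>, this is a fixed point of the convex function \<open>F b\<close>, and at
  \<open>b = b_c\<close> the graph of \<open>F b\<close> is tangent to the diagonal at \<open>v_c\<close>.  There the linearisation has the
  simple eigenvalue \<open>1\<close> and one in \<open>[0, 1)\<close>.  Along the neutral direction the distance \<open>z\<close> to the
  fixed point satisfies \<open>z (n + 1) = z n - A * (z n)^2 + O((z n)^3)\<close>, that is
  \<open>1 / z (n + 1) = 1 / z n + A + O(z n)\<close>, and the other coordinate is \<open>O((z n)^2)\<close>.
\<close>

subsection \<open>Recursion for the partition function\<close>

text \<open>The index is shifted by one against \<open>plane_trees\<close>, which makes room for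
  level \<open>0\<close>: the bare root as an external node, of weight \<open>1\<close>, from which
  the recursion starts.\<close>

definition trees_upto :: "nat \<Rightarrow> plane_tree set" where
  "trees_upto m = {\<omega>. \<forall>i\<in>vertices \<omega>. length i \<le> m}"

definition inner_nodes :: "nat \<Rightarrow> plane_tree \<Rightarrow> nat list set" where
  "inner_nodes m \<omega> = {i \<in> vertices \<omega>. length i < m}"

text \<open>Probability and Boltzmann factor are merged node by node, so that the weight is a single
  product that splits over the subtrees of the root.\<close>

definition inner_weight :: "nat pmf \<Rightarrow> real \<Rightarrow> nat \<Rightarrow> nat \<Rightarrow> plane_tree \<Rightarrow> real" where
  "inner_weight p \<beta> x m \<omega> =
     (\<Prod>i\<in>inner_nodes m \<omega>. pmf p (offspring i \<omega>) *
        exp (- \<beta> * interaction (parent_offspring x \<omega> i) (offspring i \<omega>)))"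

lemma plane_trees_eq: "plane_trees n = trees_upto (Suc n)"
  by (simp add: plane_trees_def trees_upto_def)

lemma finite_inner_nodes [simp]: "finite (inner_nodes m \<omega>)"
  unfolding inner_nodes_def using finite_vertices by simp

lemma tree_weight_eq: "tree_weight p \<beta> x n \<omega> = inner_weight p \<beta> x (Suc n) \<omega>"
proof -
  have "nodes n \<omega> = inner_nodes (Suc n) \<omega>"
    by (auto simp: nodes_def inner_nodes_def)
  then show ?thesis
    by (simp add: tree_weight_def gw_prob_def hamiltonian_def inner_weight_def prod.distrib
        sum_distrib_left sum_negf[symmetric] exp_sum[symmetric] del: sum_negf)
qed

lemma vertices_Node:
  "vertices (Node ts) = insert [] (\<Union>j<length ts. (#) j ` vertices (ts ! j))"
proof (rule set_eqI)
  fix i show "i \<in> vertices (Node ts) \<longleftrightarrow>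
    i \<in> insert [] (\<Union>j<length ts. (#) j ` vertices (ts ! j))"
    by (cases i) (auto simp: vertices_def)
qed

lemma vertices_nonempty [simp]: "vertices \<omega> \<noteq> {}"
proof -
  have "[] \<in> vertices \<omega>" by (simp add: vertices_def)
  then show ?thesis by blast
qed

lemma trees_upto_0: "trees_upto 0 = {Node []}"
proof -
  have "\<omega> \<in> trees_upto 0 \<longleftrightarrow> \<omega> = Node []" for \<omega>
  proof (cases \<omega>)
    case (Node ts)
    then show ?thesis
      by (cases ts) (auto simp: trees_upto_def vertices_Node intro!: bexI[of _ "0::nat"])
  qed
  then show ?thesis by blast
qed

lemma trees_upto_Suc: "trees_upto (Suc m) = Node ` {ts. set ts \<subseteq> trees_upto m}"
proof -
  have "Node ts \<in> trees_upto (Suc m) \<longleftrightarrow> set ts \<subseteq> trees_upto m" for ts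
    by (auto simp: trees_upto_def vertices_Node set_conv_nth subset_iff)
  then have "\<omega> \<in> trees_upto (Suc m) \<longleftrightarrow> \<omega> \<in> Node ` {ts. set ts \<subseteq> trees_upto m}" for \<omega>
    by (cases \<omega>) auto
  then show ?thesis by blast
qed

lemma parent_offspring_Cons:
  "parent_offspring x (Node ts) (j # i) = parent_offspring (length ts) (ts ! j) i"
  by (simp add: parent_offspring_def)

lemma inner_weight_0: "inner_weight p \<beta> x 0 \<omega> = 1"
  by (simp add: inner_weight_def inner_nodes_def)

text \<open>The nodes below the root split into disjoint copies of the nodes of the subtrees. Each
  subtree sees \<open>length ts\<close>, the offspring number of the root, as its boundary
  condition.\<close>

lemma inner_weight_Suc:
  "inner_weight p \<beta> x (Suc m) (Node ts) =
     pmf p (length ts) * exp (- \<beta> * interaction x (length ts)) *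
       prod_list (map (inner_weight p \<beta> (length ts) m) ts)"
proof -
  let ?I = "\<lambda>j. (#) j ` inner_nodes m (ts ! j)"
  let ?f = "\<lambda>i. pmf p (offspring i (Node ts)) *
        exp (- \<beta> * interaction (parent_offspring x (Node ts) i) (offspring i (Node ts)))"
  have nodes: "inner_nodes (Suc m) (Node ts) = insert [] (\<Union>j<length ts. ?I j)"
    by (auto simp: inner_nodes_def vertices_Node)
  have "inner_weight p \<beta> x (Suc m) (Node ts) = ?f [] * (\<Prod>i\<in>(\<Union>j<length ts. ?I j). ?f i)"
    unfolding inner_weight_def nodes by (subst prod.insert) auto
  also have "(\<Prod>i\<in>(\<Union>j<length ts. ?I j). ?f i) = (\<Prod>j<length ts. \<Prod>i\<in>?I j. ?f i)"
    by (rule prod.UNION_disjoint) auto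
  also have "\<dots> = (\<Prod>j<length ts. inner_weight p \<beta> (length ts) m (ts ! j))"
    by (simp add: prod.reindex inner_weight_def parent_offspring_Cons)
  also have "\<dots> = prod_list (map (inner_weight p \<beta> (length ts) m) ts)"
    by (simp add: prod.list_conv_set_nth atLeast0LessThan)
  finally show ?thesis
    by (simp add: parent_offspring_def)
qed

lemma inner_weight_nonneg: "inner_weight p \<beta> x m \<omega> \<ge> 0"
  unfolding inner_weight_def by (intro prod_nonneg) simp

text \<open>The boundary condition enters only through the indicator of \<open>x \<ge> 2\<close>, so
  the two values \<open>1\<close> and \<open>2\<close> suffice for a closed recursion.\<close>

lemma inner_weight_cong:
  assumes "x \<ge> 2 \<longleftrightarrow> y \<ge> 2"
  shows "inner_weight p \<beta> x m = inner_weight p \<beta> y m"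
  unfolding inner_weight_def parent_offspring_def interaction_def
  using assms by (intro ext prod.cong) auto

text \<open>Subtrees are chosen independently, so their total weights multiply. Nonnegativity gives
  the summability on the product set that iterated summation requires.\<close>

lemma has_sum_prod_list:
  fixes f :: "'a \<Rightarrow> real"
  assumes "(f has_sum S) T" and nonneg: "\<And>t. f t \<ge> 0"
  shows "((\<lambda>ts. prod_list (map f ts)) has_sum S ^ k) {ts. set ts \<subseteq> T \<and> length ts = k}"
proof (induction k)
  case 0
  have "{ts. set ts \<subseteq> T \<and> length ts = 0} = {[]}" by auto
  then show ?case using has_sum_finite[of "{[]}" "\<lambda>ts. prod_list (map f ts)"] by simp
next
  case (Suc k)
  let ?L = "{ts. set ts \<subseteq> T \<and> length ts = k}"
  have "((\<lambda>(t, ts). f t * prod_list (map f ts)) has_sum S * S ^ k) (T \<times> ?L)"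
  proof (rule has_sum_SigmaI)
    show "((\<lambda>ts. case (t, ts) of (t, ts) \<Rightarrow> f t * prod_list (map f ts)) has_sum f t * S ^ k) ?L" for t
      using has_sum_cmult_right[OF Suc] by simp
    show "((\<lambda>t. f t * S ^ k) has_sum S * S ^ k) T"
      using has_sum_cmult_left[OF assms(1)] .
    show "(\<lambda>(t, ts). f t * prod_list (map f ts)) summable_on T \<times> ?L"
    proof (rule summable_on_SigmaI)
      show "((\<lambda>ts. case (t, ts) of (t, ts) \<Rightarrow> f t * prod_list (map f ts)) has_sum f t * S ^ k) ?L" for t
        using has_sum_cmult_right[OF Suc] by simp
      show "(\<lambda>t. f t * S ^ k) summable_on T"
        using has_sum_cmult_left[OF assms(1)] by (rule has_sum_imp_summable)
    qed (auto intro!: mult_nonneg_nonneg prod_list_nonneg simp: nonneg)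
  qed
  moreover have "bij_betw (\<lambda>(t, ts). t # ts) (T \<times> ?L) {ts. set ts \<subseteq> T \<and> length ts = Suc k}"
    by (rule bij_betwI[where g = "\<lambda>ts. (hd ts, tl ts)"]) (auto simp: length_Suc_conv)
  ultimately show ?case
    by (subst has_sum_reindex_bij_betw[symmetric]) (auto simp: case_prod_unfold)
qed

text \<open>Trees are grouped by the offspring number \<open>k\<close> of the root. The values
  \<open>k = 0\<close> and \<open>k = 1\<close> give the first two terms; those with
  \<open>k \<ge> 2\<close> give the tail, with the factor \<open>exp \<beta>\<close> when the
  boundary condition is also at least \<open>2\<close>.\<close>

lemma inner_weight_has_sum_Suc:
  assumes one: "(inner_weight p \<beta> 1 m has_sum U) (trees_upto m)"
    and two: "(inner_weight p \<beta> 2 m has_sum V) (trees_upto m)"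
    and summable: "(\<lambda>k. pmf p k * V ^ k) summable_on {2..}"
  shows "(inner_weight p \<beta> x (Suc m) has_sum
      pmf p 0 + pmf p 1 * U + (if x \<ge> 2 then exp \<beta> else 1) * tail_gf p V) (trees_upto (Suc m))"
proof -
  \<comment> \<open>\<open>?h k\<close> is the total weight of one subtree attached to a root with
    \<open>k\<close> children.\<close>
  let ?T = "trees_upto m" and ?h = "\<lambda>k. if k \<ge> 2 then V else U"
  let ?g = "\<lambda>k. pmf p k * exp (- \<beta> * interaction x k)"
  let ?w = "\<lambda>(k, ts). inner_weight p \<beta> x (Suc m) (Node ts)"
  let ?b = "if x \<ge> 2 then exp \<beta> else 1"
  have V: "V \<ge> 0" using two inner_weight_nonneg by (rule has_sum_nonneg)
  have inner: "((\<lambda>ts. ?w (k, ts)) has_sum ?g k * ?h k ^ k)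
      {ts. set ts \<subseteq> ?T \<and> length ts = k}" for k
  proof -
    have "inner_weight p \<beta> k m = inner_weight p \<beta> (if k \<ge> 2 then 2 else 1) m"
      by (rule inner_weight_cong) auto
    then have "(inner_weight p \<beta> k m has_sum ?h k) ?T"
      using one two by auto
    from has_sum_cmult_right[OF has_sum_prod_list[OF this inner_weight_nonneg], of "?g k" k]
    show ?thesis
      by (rule has_sum_cong[THEN iffD1, rotated]) (auto simp: inner_weight_Suc)
  qed
  have "((\<lambda>k. ?g k * ?h k ^ k) has_sum (\<Sum>k\<in>{0, 1}. ?g k * ?h k ^ k)) {0, 1}"
    by (rule has_sum_finite) simp
  moreover have "((\<lambda>k. ?b * (pmf p k * V ^ k)) has_sum ?b * tail_gf p V) {2..}"
    unfolding tail_gf_def by (intro has_sum_cmult_right has_sum_infsum summable)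
  then have "((\<lambda>k. ?g k * ?h k ^ k) has_sum ?b * tail_gf p V) {2..}"
    by (rule has_sum_cong[THEN iffD1, rotated]) (auto simp: interaction_def)
  ultimately have "((\<lambda>k. ?g k * ?h k ^ k) has_sum
      (\<Sum>k\<in>{0, 1}. ?g k * ?h k ^ k) + ?b * tail_gf p V) ({0, 1} \<union> {2..})"
    by (rule has_sum_Un_disjoint) auto
  moreover have "{0, 1} \<union> {2..} = (UNIV :: nat set)" by auto
  ultimately have outer: "((\<lambda>k. ?g k * ?h k ^ k) has_sum
      pmf p 0 + pmf p 1 * U + ?b * tail_gf p V) UNIV"
    by (simp add: interaction_def)
  have "(?w has_sum pmf p 0 + pmf p 1 * U + ?b * tail_gf p V)
      (SIGMA k:UNIV. {ts. set ts \<subseteq> ?T \<and> length ts = k})"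
    by (rule has_sum_SigmaI[OF inner outer], rule summable_on_SigmaI[OF inner])
       (use outer in \<open>auto intro: has_sum_imp_summable inner_weight_nonneg\<close>)
  moreover have "bij_betw (\<lambda>(k, ts). Node ts)
      (SIGMA k:UNIV. {ts. set ts \<subseteq> ?T \<and> length ts = k}) (trees_upto (Suc m))"
    unfolding trees_upto_Suc
    by (rule bij_betwI[where g = "\<lambda>t. (length (children t), children t)"]) auto
  ultimately show ?thesis
    by (subst has_sum_reindex_bij_betw[symmetric]) (auto simp: case_prod_unfold)
qed

lemma inner_weight_has_sum_0: "(inner_weight p \<beta> x 0 has_sum 1) (trees_upto 0)"
  using has_sum_finite[of "{Node []}" "inner_weight p \<beta> x 0"]
  by (simp add: trees_upto_0 inner_weight_0)

lemma partition_function_recursion: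
  assumes summable: "\<And>v::real. v \<ge> 0 \<Longrightarrow> (\<lambda>k. pmf p k * v ^ k) summable_on {2..}"
  shows tree_weight_summable: "tree_weight p \<beta> x n summable_on plane_trees n"
    and \<Xi>_0: "\<Xi> p \<beta> x 0 =
      pmf p 0 + pmf p 1 + (if x \<ge> 2 then exp \<beta> else 1) * tail_gf p 1"
    and \<Xi>_Suc: "\<Xi> p \<beta> x (Suc n) =
      pmf p 0 + pmf p 1 * \<Xi> p \<beta> 1 n + (if x \<ge> 2 then exp \<beta> else 1) * tail_gf p (\<Xi> p \<beta> 2 n)"
proof -
  \<comment> \<open>The induction runs over all \<open>x\<close> at once, since every step uses the
    sums for both \<open>1\<close> and \<open>2\<close>.\<close>
  have ex: "\<exists>S. (inner_weight p \<beta> x m has_sum S) (trees_upto m)" for x m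
  proof (induction m arbitrary: x)
    case 0
    then show ?case using inner_weight_has_sum_0 by blast
  next
    case (Suc m)
    then obtain U V where "(inner_weight p \<beta> 1 m has_sum U) (trees_upto m)"
      and V: "(inner_weight p \<beta> 2 m has_sum V) (trees_upto m)" by meson
    moreover have "V \<ge> 0" using V inner_weight_nonneg by (rule has_sum_nonneg)
    ultimately show ?case using inner_weight_has_sum_Suc summable by blast
  qed
  have tw: "tree_weight p \<beta> x n = inner_weight p \<beta> x (Suc n)" for x n
    by (rule ext) (rule tree_weight_eq)
  show "tree_weight p \<beta> x n summable_on plane_trees n"
    unfolding plane_trees_eq tw using ex by (auto simp: summable_on_def)
  have \<Xi>: "(inner_weight p \<beta> x (Suc n) has_sum \<Xi> p \<beta> x n) (trees_upto (Suc n))" for x n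
    unfolding \<Xi>_def plane_trees_eq tw using ex by (auto intro!: has_sum_infsum simp: summable_on_def)
  show "\<Xi> p \<beta> x 0 = pmf p 0 + pmf p 1 + (if x \<ge> 2 then exp \<beta> else 1) * tail_gf p 1"
    using has_sum_unique[OF \<Xi> inner_weight_has_sum_Suc[OF inner_weight_has_sum_0
        inner_weight_has_sum_0 summable]] by simp
  have "\<Xi> p \<beta> 2 n \<ge> 0" using \<Xi> inner_weight_nonneg by (rule has_sum_nonneg)
  from has_sum_unique[OF \<Xi> inner_weight_has_sum_Suc[OF \<Xi> \<Xi> summable[OF this]]]
  show "\<Xi> p \<beta> x (Suc n) =
      pmf p 0 + pmf p 1 * \<Xi> p \<beta> 1 n + (if x \<ge> 2 then exp \<beta> else 1) * tail_gf p (\<Xi> p \<beta> 2 n)" .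
qed

subsection \<open>The critical pair\<close>

locale convex_series =
  fixes c :: "nat \<Rightarrow> real"
  assumes coeff_nonneg: "c k \<ge> 0"
    and summable_powers: "summable (\<lambda>k. c k * v ^ k)"
    and nonlinear: "\<exists>k\<ge>2. c k > 0"
begin

text \<open>The \<open>m\<close>-th derivative of the series, expressed through its coefficients, so
  that signs and monotonicity on the positive axis follow from nonnegativity.\<close>

definition S :: "nat \<Rightarrow> real \<Rightarrow> real" where
  "S m v = (\<Sum>k. (diffs ^^ m) c k * v ^ k)"

lemma diffs_coeff_nonneg: "(diffs ^^ m) c k \<ge> 0"
  by (induction m arbitrary: k) (auto simp: coeff_nonneg diffs_def)

lemma diffs_summable: "summable (\<lambda>k. (diffs ^^ m) c k * v ^ k)"
  by (induction m arbitrary: v) (auto simp: summable_powers intro!: termdiff_converges_all)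

lemma DERIV_S: "(S m has_real_derivative S (Suc m) v) (at v)"
  unfolding S_def using termdiffs_strong_converges_everywhere[OF diffs_summable] by simp

lemma S_nonneg: "v \<ge> 0 \<Longrightarrow> S m v \<ge> 0"
  unfolding S_def by (intro suminf_nonneg diffs_summable mult_nonneg_nonneg diffs_coeff_nonneg) auto

text \<open>Differentiation moves a positive coefficient from index \<open>k\<close> to
  \<open>k - 1\<close>, so \<open>k + m\<close> is preserved. Starting from an index of at least
  \<open>2\<close>, two derivatives do not annihilate it.\<close>

lemma diffs_coeff_pos: "m \<le> 2 \<Longrightarrow> \<exists>k. k + m \<ge> 2 \<and> (diffs ^^ m) c k > 0"
proof (induction m)
  case 0
  then show ?case using nonlinear by auto
next
  case (Suc m)
  then obtain k where k: "k + m \<ge> 2" "(diffs ^^ m) c k > 0" by auto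
  with Suc.prems obtain j where "k = Suc j" by (cases k) auto
  with k show ?case
    by (intro exI[of _ j]) (auto simp: diffs_def[of "(diffs ^^ m) c"])
qed

lemma S_pos:
  assumes "m \<le> 2" "v > 0"
  shows "S m v > 0"
proof -
  obtain k where "(diffs ^^ m) c k > 0" using diffs_coeff_pos[OF assms(1)] by auto
  then show ?thesis
    unfolding S_def using assms(2)
    by (intro suminf_pos2[of _ k] diffs_summable mult_nonneg_nonneg diffs_coeff_nonneg) auto
qed

lemma isCont_S: "isCont (S m) v"
  using DERIV_S by (rule DERIV_isCont)

lemma S_mono:
  assumes "0 \<le> v" "v \<le> w"
  shows "S m v \<le> S m w"
  using assms(2) by (rule DERIV_nonneg_imp_nondecreasing) (use DERIV_S S_nonneg assms in force)

lemma S_strict_mono: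
  assumes "m \<le> 1" "0 < v" "v < w"
  shows "S m v < S m w"
  using assms(3) by (rule DERIV_pos_imp_increasing) (use DERIV_S S_pos[of "Suc m"] assms in force)

lemma deriv_S: "deriv (S m) v = S (Suc m) v"
  using DERIV_S by (rule DERIV_imp_deriv)

text \<open>Strict convexity on the positive axis, from the Lagrange remainder with
  \<open>S 2 t > 0\<close>.\<close>

lemma S_tangent_less:
  assumes "0 < v" "0 < w" "v \<noteq> w"
  shows "S 0 w + S 1 w * (v - w) < S 0 v"
proof -
  obtain t where t: "if v < w then v < t \<and> t < w else w < t \<and> t < v"
    and eq: "S 0 v = (\<Sum>m<2. S m w / fact m * (v - w) ^ m) + S 2 t / fact 2 * (v - w) ^ 2"
    using Taylor[of 2 S "S 0" "min v w" "max v w" w v] DERIV_S assms by auto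
  from t assms have "t > 0" by (auto split: if_splits)
  then have "S 2 t / fact 2 * (v - w) ^ 2 > 0" using assms S_pos[of 2 t] by simp
  with eq show ?thesis by (simp add: numeral_2_eq_2)
qed

text \<open>The Lagrange point lies between \<open>w - y \<ge> 0\<close> and \<open>w\<close>, where
  \<open>S 3\<close> is nonnegative and at most \<open>S 3 w\<close>.\<close>

lemma S_Taylor2_error:
  assumes "0 \<le> y" "y \<le> w"
  shows "\<bar>S 0 (w - y) - (S 0 w - S 1 w * y + S 2 w / 2 * y\<^sup>2)\<bar> \<le> S 3 w / 6 * y ^ 3"
proof (cases "y = 0")
  case False
  then obtain t where t: "w - y < t" "t < w"
    and eq: "S 0 (w - y) = (\<Sum>m<3. S m w / fact m * (w - y - w) ^ m) + S 3 t / fact 3 * (w - y - w) ^ 3"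
    using Taylor[of 3 S "S 0" "w - y" w w "w - y"] DERIV_S assms by auto
  have "S 0 (w - y) - (S 0 w - S 1 w * y + S 2 w / 2 * y\<^sup>2) = - (S 3 t / 6 * y ^ 3)"
    unfolding eq by (simp add: eval_nat_numeral algebra_simps)
  moreover have "0 \<le> S 3 t" "S 3 t \<le> S 3 w"
    using t assms by (auto intro!: S_nonneg S_mono)
  ultimately show ?thesis using assms by (auto intro!: mult_right_mono)
qed auto

end

text \<open>With \<open>S 0\<close> in the role of \<open>tail_gf p\<close>, \<open>total\<close> is
  the normalisation of the offspring law and \<open>p1 + S 1 1\<close> is its mean.\<close>

locale gw_series = convex_series +
  fixes p0 p1 :: real
  assumes p0_pos: "p0 > 0" and p1_nonneg: "p1 \<ge> 0"
    and total: "p0 + p1 + S 0 1 = 1"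
    and subcritical: "p1 + S 1 1 < 1"
begin

lemma p01: "p0 + p1 < 1" "p1 < 1" "p0 / (1 - p1) < 1"
proof -
  show "p0 + p1 < 1" using total S_pos[of 0 1] by simp
  then show "p1 < 1" "p0 / (1 - p1) < 1" using p0_pos by (auto simp: divide_simps)
qed

text \<open>Eliminating \<open>b\<close> from the critical system leaves the equation \<open>G v = 0\<close>.\<close>

definition G :: "real \<Rightarrow> real" where
  "G v = (v - p0 / (1 - p1)) * S 1 v - S 0 v"

lemma DERIV_G: "(G has_real_derivative (v - p0 / (1 - p1)) * S 2 v) (at v)"
  unfolding G_def
  by (rule derivative_eq_intros DERIV_S refl)+ (simp add: numeral_2_eq_2)

lemma G_strict_mono:
  assumes "1 \<le> v" "v < w"
  shows "G v < G w"
  using assms(2)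
proof (rule DERIV_pos_imp_increasing)
  fix x assume "v \<le> x" "x \<le> w"
  then have "(x - p0 / (1 - p1)) * S 2 x > 0"
    using assms p01(3) by (intro mult_pos_pos S_pos) auto
  then show "\<exists>y. DERIV G x :> y \<and> 0 < y" using DERIV_G by blast
qed

text \<open>This is where subcriticality enters: by \<open>total\<close>, the sign of
  \<open>G 1\<close> is that of the mean offspring number minus \<open>1\<close>.\<close>

lemma G_1: "G 1 < 0"
proof -
  have "(1 - p1) * G 1 = S 0 1 * (p1 + S 1 1 - 1)"
  proof -
    have "(1 - p1) * G 1 = (1 - p1 - p0) * S 1 1 - (1 - p1) * S 0 1"
      unfolding G_def using p01 by (simp add: field_simps)
    also have "1 - p1 - p0 = S 0 1" using total by simp
    finally show ?thesis by (simp add: algebra_simps)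
  qed
  also have "\<dots> < 0" using subcritical S_pos[of 0 1] by (intro mult_pos_neg) auto
  finally show ?thesis using p01 by (simp add: mult_less_0_iff)
qed

lemma G_zero_ex: "\<exists>v>1. G v = 0"
proof -
  \<comment> \<open>\<open>s\<close> is the derivative of \<open>G\<close> at \<open>1\<close> and
    bounds it from below on \<open>[1, \<infinity>)\<close>. Hence \<open>G\<close> has climbed from
    \<open>G 1\<close> to at least \<open>0\<close> by the time it reaches \<open>w\<close>.\<close>
  define s where "s = (1 - p0 / (1 - p1)) * S 2 1"
  define w where "w = 1 - G 1 / s"
  have s: "s > 0" unfolding s_def using p01 S_pos[of 2 1] by (intro mult_pos_pos) auto
  then have w: "w > 1" unfolding w_def using G_1 by (simp add: divide_neg_pos)
  obtain t where t: "1 < t" "t < w" "G w - G 1 = (w - 1) * ((t - p0 / (1 - p1)) * S 2 t)"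
    using MVT2[OF w DERIV_G] by blast
  have "s \<le> (t - p0 / (1 - p1)) * S 2 t"
    unfolding s_def
  proof (rule mult_mono)
    show "0 \<le> t - p0 / (1 - p1)" using t(1) p01(3) by linarith
  qed (use t S_mono[of 1 t 2] S_nonneg[of 1 2] in auto)
  then have "(w - 1) * s \<le> G w - G 1" using t w by (simp add: mult_left_mono)
  moreover have "(w - 1) * s = - G 1" using s by (simp add: w_def)
  ultimately have "G w \<ge> 0" by simp
  moreover have "continuous_on {1..w} G"
    using DERIV_isCont[OF DERIV_G] by (intro continuous_at_imp_continuous_on ballI)
  ultimately obtain v where v: "1 \<le> v" "v \<le> w" "G v = 0"
    using IVT'[of G 1 0 w] G_1 w by auto
  with G_1 show ?thesis by (metis less_eq_real_def less_irrefl)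
qed

definition v_c :: real where "v_c = (SOME v. v > 1 \<and> G v = 0)"

lemma v_c: "v_c > 1" "G v_c = 0"
  using someI_ex[OF G_zero_ex] by (auto simp: v_c_def)

lemma G_zero_iff: "v \<ge> 1 \<Longrightarrow> G v = 0 \<longleftrightarrow> v = v_c"
  using v_c G_strict_mono[of v v_c] G_strict_mono[of v_c v] by (cases v v_c rule: linorder_cases) auto

text \<open>Also equal to \<open>(b - 1) * (1 - p1) + 1\<close>, so the constant \<open>a\<close> of
  the theorem is \<open>1 / K b_c\<close>.\<close>

definition K :: "real \<Rightarrow> real" where "K b = (1 - p1) * b + p1"

text \<open>The right-hand side of the first critical equation. Its fixed points are the second
  coordinates of the fixed points of the recursion, by \<open>fixpoint_iff\<close>.\<close>

definition F :: "real \<Rightarrow> real \<Rightarrow> real" where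
  "F b v = p0 / (1 - p1) + K b / (1 - p1) * S 0 v"

text \<open>The second critical equation at \<open>v = v_c\<close>, solved for
  \<open>b\<close>.\<close>

definition b_c :: real where "b_c = 1 / S 1 v_c - p1 / (1 - p1)"

lemma S_v_c_pos: "m \<le> 2 \<Longrightarrow> S m v_c > 0"
  using v_c by (intro S_pos) auto

lemma K_b_c: "K b_c = (1 - p1) / S 1 v_c"
  unfolding K_def b_c_def using p01 by (simp add: right_diff_distrib)

lemma K_b_c_div: "K b_c / (1 - p1) = 1 / S 1 v_c"
  unfolding K_b_c using p01 by simp

lemma F_b_c: "F b_c v_c = v_c"
proof -
  have "F b_c v_c = p0 / (1 - p1) + S 0 v_c / S 1 v_c" unfolding F_def K_b_c_div by simp
  moreover have "S 0 v_c / S 1 v_c = v_c - p0 / (1 - p1)"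
    using v_c(2) S_v_c_pos[of 1] unfolding G_def by (simp add: divide_simps)
  ultimately show ?thesis by simp
qed

text \<open>By the two critical equations the tangent of \<open>F b_c\<close> at \<open>v_c\<close>
  is the diagonal, and strict convexity keeps the graph above it elsewhere.\<close>

lemma F_b_c_greater:
  assumes "v > 0" "v \<noteq> v_c"
  shows "F b_c v > v"
proof -
  let ?C = "K b_c / (1 - p1)"
  have C: "?C > 0" and CS: "?C * S 1 v_c = 1" unfolding K_b_c_div using S_v_c_pos[of 1] by auto
  have "v = F b_c v_c + ?C * S 1 v_c * (v - v_c)" unfolding CS F_b_c by simp
  also have "\<dots> = p0 / (1 - p1) + ?C * (S 0 v_c + S 1 v_c * (v - v_c))"
    by (simp add: F_def distrib_left mult.assoc)
  also have "\<dots> < F b_c v"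
    unfolding F_def using S_tangent_less[of v v_c] assms v_c(1) C
    by (intro add_strict_left_mono mult_strict_left_mono) auto
  finally show ?thesis .
qed

text \<open>Since \<open>K 1 = 1\<close>, \<open>total\<close> makes \<open>1\<close> a fixed point
  of \<open>F 1\<close>, whereas \<open>F b_c 1 > 1\<close>.\<close>

lemma b_c_gt_1: "b_c > 1"
proof -
  have "p0 / (1 - p1) + K b_c / (1 - p1) * S 0 1 > 1"
    using F_b_c_greater[of 1] v_c by (simp add: F_def)
  then have "(1 - p1) * 1 < (1 - p1) * (p0 / (1 - p1) + K b_c / (1 - p1) * S 0 1)"
    using p01 by (intro mult_strict_left_mono) auto
  also have "\<dots> = p0 + K b_c * S 0 1" using p01 by (simp add: distrib_left)
  finally have "p0 + K b_c * S 0 1 > 1 - p1" by simp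
  then have "K b_c * S 0 1 > S 0 1" using total by simp
  then have "K b_c > 1" using S_pos[of 0 1] by simp
  then have "(1 - p1) * b_c > (1 - p1) * 1" unfolding K_def by simp
  then show ?thesis using p01 by (simp del: mult_1_right)
qed

text \<open>Multiplying the first equation by \<open>S 1 v\<close> and inserting the second removes
  \<open>b\<close> and leaves \<open>G v = 0\<close>, whose only root from \<open>1\<close> on is
  \<open>v_c\<close>. The second equation then determines \<open>b\<close>.\<close>

lemma critical_system_iff:
  "v \<ge> 1 \<and> v = F b v \<and> 1 = K b / (1 - p1) * S 1 v \<longleftrightarrow> b = b_c \<and> v = v_c"
proof (intro iffI conjI; (elim conjE)?)
  assume v: "v \<ge> 1" "v = F b v" and K: "1 = K b / (1 - p1) * S 1 v"
  have S1: "S 1 v > 0" using v by (intro S_pos) auto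
  have "v - p0 / (1 - p1) = K b / (1 - p1) * S 0 v"
    using v(2) unfolding F_def by linarith
  then have "(v - p0 / (1 - p1)) * S 1 v = (K b / (1 - p1) * S 1 v) * S 0 v"
    by simp
  then have "G v = 0" unfolding K[symmetric] by (simp add: G_def)
  then show v': "v = v_c" using v G_zero_iff by simp
  have "K b / (1 - p1) = 1 / S 1 v_c" using K S1 unfolding v' by (metis less_irrefl nonzero_eq_divide_eq)
  then have "K b = K b_c" using p01 unfolding K_b_c by (metis diff_gt_0_iff_gt divide_divide_eq_right less_irrefl mult_1 nonzero_divide_eq_eq times_divide_eq_left)
  then show "b = b_c" using p01 by (simp add: K_def)
next
  show "1 = K b / (1 - p1) * S 1 v" if "b = b_c" "v = v_c"
    using that S_v_c_pos[of 1] by (simp add: K_b_c_div)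
qed (use v_c F_b_c in auto)

lemma F_strict_mono:
  assumes "v > 0" "b < b'"
  shows "F b v < F b' v"
  unfolding F_def K_def using assms S_pos[of 0 v] p01
  by (intro add_strict_left_mono mult_strict_right_mono divide_strict_right_mono) auto

lemma fixpoint_iff:
  "u = p0 + p1 * u + S 0 v \<and> v = p0 + p1 * u + b * S 0 v \<longleftrightarrow>
     u = (p0 + S 0 v) / (1 - p1) \<and> v = F b v"
proof -
  have "u = p0 + p1 * u + S 0 v \<longleftrightarrow> u * (1 - p1) = p0 + S 0 v"
    by (auto simp: algebra_simps)
  then have "u = p0 + p1 * u + S 0 v \<longleftrightarrow> u = (p0 + S 0 v) / (1 - p1)"
    using p01 by (simp add: eq_divide_eq)
  moreover have "p0 + p1 * ((p0 + S 0 v) / (1 - p1)) + b * S 0 v = F b v"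
    unfolding F_def K_def using p01 by (simp add: divide_simps) (simp add: algebra_simps)
  ultimately show ?thesis by metis
qed

end

subsection \<open>Recursions with quadratic drift\<close>

text \<open>\<open>w\<close> contracts by the factor \<open>\<kappa>\<close>, while \<open>z\<close>
  shrinks more slowly than any geometric sequence. A bound \<open>D * z n ^ 2\<close> on
  \<open>w n\<close> therefore reproduces itself once \<open>D\<close> dominates the forcing
  \<open>e\<close>.\<close>

lemma geometric_perturbation_bigo:
  fixes w e z :: "nat \<Rightarrow> real"
  assumes w: "\<And>n. w (Suc n) = \<kappa> * w n + e n" and \<kappa>: "0 \<le> \<kappa>" "\<kappa> < 1"
    and e: "e \<in> O(\<lambda>n. z n ^ 2)"
    and pos: "\<And>n. z n > 0" and lim: "z \<longlonglongrightarrow> 0"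
    and slow: "(\<lambda>n. z (Suc n) - z n) \<in> O(\<lambda>n. z n ^ 2)"
  shows "w \<in> O(\<lambda>n. z n ^ 2)"
proof -
  \<comment> \<open>Any rate strictly between \<open>\<kappa>\<close> and \<open>1\<close> would do:
    eventually \<open>z (Suc n) ^ 2\<close> is at least \<open>\<mu> * z n ^ 2\<close>.\<close>
  define \<mu> where "\<mu> = (1 + \<kappa>) / 2"
  have \<mu>: "\<kappa> < \<mu>" "\<mu> < 1" using \<kappa> by (auto simp: \<mu>_def)
  obtain C where C: "C > 0" "eventually (\<lambda>n. \<bar>e n\<bar> \<le> C * z n ^ 2) sequentially"
    using e by (auto elim!: landau_o.bigE)
  obtain L where L: "L > 0" "eventually (\<lambda>n. \<bar>z (Suc n) - z n\<bar> \<le> L * z n ^ 2) sequentially"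
    using slow by (auto elim!: landau_o.bigE)
  have "(\<lambda>n. (1 - L * z n) ^ 2) \<longlonglongrightarrow> (1 - L * 0) ^ 2"
    by (intro tendsto_intros lim)
  then have "eventually (\<lambda>n. (1 - L * z n) ^ 2 > \<mu>) sequentially"
    using \<mu> by (intro order_tendstoD) auto
  moreover have "(\<lambda>n. 1 - L * z n) \<longlonglongrightarrow> 1 - L * 0"
    by (intro tendsto_intros lim)
  then have "eventually (\<lambda>n. 1 - L * z n > 0) sequentially"
    by (intro order_tendstoD) auto
  ultimately have "eventually (\<lambda>n. \<bar>e n\<bar> \<le> C * z n ^ 2 \<and>
      \<bar>z (Suc n) - z n\<bar> \<le> L * z n ^ 2 \<and> (1 - L * z n) ^ 2 > \<mu> \<and> 1 - L * z n > 0) sequentially"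
    using C(2) L(2) by eventually_elim simp
  then obtain N where N: "\<And>n. n \<ge> N \<Longrightarrow> \<bar>e n\<bar> \<le> C * z n ^ 2"
      "\<And>n. n \<ge> N \<Longrightarrow> \<bar>z (Suc n) - z n\<bar> \<le> L * z n ^ 2"
      "\<And>n. n \<ge> N \<Longrightarrow> (1 - L * z n) ^ 2 > \<mu>" "\<And>n. n \<ge> N \<Longrightarrow> 1 - L * z n > 0"
    unfolding eventually_sequentially by blast
  \<comment> \<open>The first entry starts the induction at \<open>N\<close>; the second absorbs the
    forcing into the gap \<open>\<mu> - \<kappa>\<close>.\<close>
  define D where "D = max (\<bar>w N\<bar> / z N ^ 2) (C / (\<mu> - \<kappa>))"
  have D: "D \<ge> 0" "\<bar>w N\<bar> \<le> D * z N ^ 2" "C \<le> (\<mu> - \<kappa>) * D"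
  proof -
    have "\<bar>w N\<bar> / z N ^ 2 \<le> D" "C / (\<mu> - \<kappa>) \<le> D" by (auto simp: D_def)
    then show "\<bar>w N\<bar> \<le> D * z N ^ 2" "C \<le> (\<mu> - \<kappa>) * D"
      using pos[of N] \<mu> by (auto simp: field_simps)
    have "0 \<le> C / (\<mu> - \<kappa>)" using C \<mu> by simp
    then show "D \<ge> 0" using \<open>C / (\<mu> - \<kappa>) \<le> D\<close> by linarith
  qed
  have "\<bar>w n\<bar> \<le> D * z n ^ 2" if "n \<ge> N" for n
    using that
  proof (induction n rule: dec_induct)
    case (step n)
    have "\<bar>w (Suc n)\<bar> \<le> \<kappa> * \<bar>w n\<bar> + \<bar>e n\<bar>"
      unfolding w using \<kappa> by (metis abs_mult abs_of_nonneg abs_triangle_ineq)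
    also have "\<dots> \<le> \<kappa> * (D * z n ^ 2) + C * z n ^ 2"
      using step N \<kappa> by (intro add_mono mult_left_mono) auto
    also have "\<dots> \<le> \<kappa> * (D * z n ^ 2) + (\<mu> - \<kappa>) * D * z n ^ 2"
      using D by (intro add_left_mono mult_right_mono) auto
    also have "\<dots> = D * (\<mu> * z n ^ 2)" by (simp add: algebra_simps)
    also have "\<dots> \<le> D * ((1 - L * z n) ^ 2 * z n ^ 2)"
      using N(3)[of n] step D by (intro mult_left_mono mult_right_mono) auto
    also have "\<dots> = D * ((1 - L * z n) * z n) ^ 2" by (simp add: power_mult_distrib)
    also have "\<dots> \<le> D * z (Suc n) ^ 2"
    proof (intro mult_left_mono power_mono D)
      show "(1 - L * z n) * z n \<le> z (Suc n)"
        using N(2)[of n] step by (auto simp: algebra_simps power2_eq_square abs_le_iff)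
      show "0 \<le> (1 - L * z n) * z n" using N(4)[of n] step pos[of n] by simp
    qed
    finally show ?case .
  qed (use D in auto)
  then show ?thesis
    by (intro bigoI[of _ D]) (auto simp: eventually_sequentially)
qed

text \<open>Reciprocals turn the quadratic drift into a constant increment \<open>A\<close>. Putting
  \<open>z' = z - A * z\<^sup>2 + d\<close> leaves only cubic terms in the numerator, and
  \<open>z' \<ge> z / 2\<close> controls the denominator.\<close>

lemma reciprocal_increment:
  fixes z z' A C :: real
  assumes "0 < z" "z \<le> 1" "z / 2 \<le> z'" "A > 0" "C > 0"
    and "\<bar>z' - (z - A * z\<^sup>2)\<bar> \<le> C * z ^ 3"
  shows "\<bar>1 / z' - 1 / z - A\<bar> \<le> 2 * (A\<^sup>2 + (A + 1) * C) * z"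
proof -
  define d where "d = z' - (z - A * z\<^sup>2)"
  have z': "z' > 0" using assms by linarith
  have "1 / z' - 1 / z - A = (z - z' - A * z * z') / (z * z')"
    using z' assms by (simp add: field_simps)
  also have "z - z' - A * z * z' = A\<^sup>2 * z ^ 3 - (A * z + 1) * d"
    unfolding d_def by (simp add: algebra_simps power2_eq_square power3_eq_cube)
  finally have eq: "1 / z' - 1 / z - A = (A\<^sup>2 * z ^ 3 - (A * z + 1) * d) / (z * z')" .
  have "\<bar>A\<^sup>2 * z ^ 3 - (A * z + 1) * d\<bar> \<le> \<bar>A\<^sup>2 * z ^ 3\<bar> + \<bar>(A * z + 1) * d\<bar>"
    by (rule abs_triangle_ineq4)
  also have "\<bar>(A * z + 1) * d\<bar> = (A * z + 1) * \<bar>d\<bar>" using assms by (simp add: abs_mult)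
  also have "\<dots> \<le> (A + 1) * (C * z ^ 3)"
    using assms unfolding d_def by (intro mult_mono) (auto simp: mult_le_cancel_left1)
  finally have "\<bar>A\<^sup>2 * z ^ 3 - (A * z + 1) * d\<bar> \<le> (A\<^sup>2 + (A + 1) * C) * z ^ 3"
    using assms by (simp add: algebra_simps)
  then have "\<bar>1 / z' - 1 / z - A\<bar> \<le> (A\<^sup>2 + (A + 1) * C) * z ^ 3 / (z * z')"
    unfolding eq using z' assms by (simp add: abs_mult divide_right_mono)
  also have "\<dots> \<le> (A\<^sup>2 + (A + 1) * C) * z ^ 3 / (z * (z / 2))"
    using assms z' by (intro divide_left_mono mult_left_mono mult_pos_pos) auto
  also have "\<dots> = 2 * (A\<^sup>2 + (A + 1) * C) * z"
    using assms by (simp add: field_simps power3_eq_cube)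
  finally show ?thesis .
qed

text \<open>Lets errors of order \<open>1 / n\<close> telescope to a logarithm. The factor
  \<open>2\<close> pays for passing from \<open>1 / Suc n\<close> to \<open>1 / n\<close>.\<close>

lemma inverse_le_ln_increment:
  assumes "n \<ge> (1::nat)"
  shows "1 / real n \<le> 2 * (ln (real (Suc n)) - ln (real n))"
proof -
  have "ln (real n / real (Suc n)) \<le> real n / real (Suc n) - 1"
    using assms by (intro ln_le_minus_one) auto
  moreover have "ln (real n / real (Suc n)) = ln (real n) - ln (real (Suc n))"
    using assms by (simp add: ln_div)
  moreover have "real n / real (Suc n) - 1 = - (1 / real (Suc n))"
    by (simp add: field_simps)
  ultimately have "1 / real (Suc n) \<le> ln (real (Suc n)) - ln (real n)" by linarith
  moreover have "1 / real n \<le> 2 * (1 / real (Suc n))"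
    using assms by (simp add: field_simps)
  ultimately show ?thesis by (auto intro: order.trans)
qed

text \<open>A bootstrap on \<open>1 / z n\<close>. Increments of at least \<open>A / 2\<close> first
  give \<open>z n = O(1 / n)\<close>; with this bound the increment errors sum to
  \<open>O(ln n)\<close>, and inverting \<open>1 / z n = A * n + O(ln n)\<close> gives the
  claim.\<close>

lemma quadratic_recursion_asymptotics:
  fixes z :: "nat \<Rightarrow> real"
  assumes pos: "\<And>n. z n > 0" and lim: "z \<longlonglongrightarrow> 0" and A: "A > 0"
    and rec: "(\<lambda>n. z (Suc n) - (z n - A * (z n)\<^sup>2)) \<in> O(\<lambda>n. z n ^ 3)"
  shows "z \<in> O(\<lambda>n. 1 / real n)"
    and "(\<lambda>n. z n - 1 / (A * real n)) \<in> O(\<lambda>n. ln (real n) / (real n)\<^sup>2)"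
proof -
  obtain C where C: "C > 0"
      "eventually (\<lambda>n. \<bar>z (Suc n) - (z n - A * (z n)\<^sup>2)\<bar> \<le> C * z n ^ 3) sequentially"
    using rec pos by (auto elim!: landau_o.bigE simp: abs_of_pos)
  define E where "E = 2 * (A\<^sup>2 + (A + 1) * C)"
  have E: "E > 0" unfolding E_def using A C by (simp add: add_pos_pos)
  have small: "eventually (\<lambda>n. z n \<le> r) sequentially" if "r > 0" for r
    using order_tendstoD(2)[OF lim that] by eventually_elim simp
  have "A + C > 0" "A / (2 * E) > 0" using A C E by auto
  \<comment> \<open>The bound \<open>1 / (2 * (A + C))\<close> ensures
    \<open>z (Suc n) \<ge> z n / 2\<close>, and \<open>A / (2 * E)\<close> keeps the increment error
    \<open>E * z n\<close> below \<open>A / 2\<close>.\<close>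
  then have "eventually (\<lambda>n. \<bar>z (Suc n) - (z n - A * (z n)\<^sup>2)\<bar> \<le> C * z n ^ 3 \<and> z n \<le> 1 \<and>
      z n \<le> 1 / (2 * (A + C)) \<and> z n \<le> A / (2 * E)) sequentially"
    by (intro eventually_conj C small) auto
  then obtain N where N: "\<And>n. n \<ge> N \<Longrightarrow> \<bar>z (Suc n) - (z n - A * (z n)\<^sup>2)\<bar> \<le> C * z n ^ 3 \<and>
      z n \<le> 1 \<and> z n \<le> 1 / (2 * (A + C)) \<and> z n \<le> A / (2 * E)"
    unfolding eventually_sequentially by blast
  have incr: "\<bar>1 / z (Suc n) - 1 / z n - A\<bar> \<le> E * z n" if "n \<ge> N" for n
    unfolding E_def
  proof (rule reciprocal_increment)
    have n: "\<bar>z (Suc n) - (z n - A * (z n)\<^sup>2)\<bar> \<le> C * z n ^ 3" "z n \<le> 1"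
      "z n \<le> 1 / (2 * (A + C))"
      using N[OF that] by auto
    have "C * z n ^ 3 \<le> C * (z n)\<^sup>2"
      using n(2) pos[of n] C by (intro mult_left_mono power_decreasing) auto
    then have "A * (z n)\<^sup>2 + C * z n ^ 3 \<le> ((A + C) * z n) * z n"
      by (simp add: algebra_simps power2_eq_square)
    also have "\<dots> \<le> 1 / 2 * z n"
      using n(3) pos[of n] \<open>A + C > 0\<close> by (intro mult_right_mono) (auto simp: field_simps)
    finally show "z n / 2 \<le> z (Suc n)" using n(1) by (auto simp: abs_le_iff)
  qed (use pos A C N[OF that] in auto)
  have "1 / z n \<ge> A / 2 * (real n - real N)" if "n \<ge> N" for n
    using that
  proof (induction n rule: dec_induct)
    case (step n)
    have "E * z n \<le> A / 2" using N[of n] step E by (auto simp: field_simps)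
    then show ?case using incr[of n] step by (auto simp: algebra_simps abs_le_iff)
  qed (use pos[of N] in auto)
  note linear = this
  have lower: "1 / z n \<ge> A / 4 * real n" if "n \<ge> 2 * N" for n
  proof -
    have "A / 4 * real n \<le> A / 2 * (real n - real N)"
      using that A by (simp add: field_simps)
    also have "\<dots> \<le> 1 / z n" using linear[of n] that by simp
    finally show ?thesis .
  qed
  \<comment> \<open>From \<open>2 * N\<close> on the lower bound on \<open>1 / z n\<close> is
    available, and from \<open>3\<close> on \<open>ln (real n) \<ge> 1\<close>, so constants can be
    absorbed into the logarithm.\<close>
  define M where "M = max (2 * N) 3"
  have upper: "z n \<le> 4 / A * (1 / real n)" if "n \<ge> M" for n
    using lower[of n] that pos[of n] A by (auto simp: M_def field_simps)
  then show "z \<in> O(\<lambda>n. 1 / real n)"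
    using pos by (intro bigoI[of _ "4 / A"]) (auto simp: eventually_sequentially abs_of_pos)
  define D where "D = \<bar>1 / z M - A * real M\<bar>"
  define E' where "E' = 8 * E / A"
  have E': "E' > 0" using E A by (simp add: E'_def)
  have dev: "\<bar>1 / z n - A * real n\<bar> \<le> D + E' * ln (real n)" if "n \<ge> M" for n
    using that
  proof (induction n rule: dec_induct)
    case base
    then show ?case using E' by (simp add: D_def M_def)
  next
    case (step n)
    have n: "n \<ge> N" "n \<ge> 1" using step by (auto simp: M_def)
    have "E * z n \<le> E * (4 / A * (1 / real n))"
      using upper[of n] step E by (intro mult_left_mono) auto
    also have "\<dots> = E' / 2 * (1 / real n)" by (simp add: E'_def)
    also have "\<dots> \<le> E' / 2 * (2 * (ln (real (Suc n)) - ln (real n)))"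
      using inverse_le_ln_increment[OF n(2)] E' by (intro mult_left_mono) auto
    finally have "E * z n \<le> E' * ln (real (Suc n)) - E' * ln (real n)"
      by (simp add: algebra_simps)
    moreover have "A * real (Suc n) = A * real n + A" by (simp add: algebra_simps)
    ultimately show ?case using incr[OF n(1)] step.IH by linarith
  qed
  have "\<bar>z n - 1 / (A * real n)\<bar> \<le> (D + E') * (4 / A\<^sup>2) * (ln (real n) / (real n)\<^sup>2)" if "n \<ge> M" for n
  proof -
    have n: "n \<ge> 3" using that by (simp add: M_def)
    have "ln (real n) \<ge> ln (exp 1)" using n exp_le by (intro ln_mono) auto
    then have "D \<le> D * ln (real n)" by (auto simp: mult_le_cancel_left1 D_def)
    then have "D + E' * ln (real n) \<le> (D + E') * ln (real n)" by (simp add: algebra_simps)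
    with dev[OF that] have dev': "\<bar>1 / z n - A * real n\<bar> \<le> (D + E') * ln (real n)" by linarith
    have "z n - 1 / (A * real n) = - ((1 / z n - A * real n) * (z n * (1 / (A * real n))))"
      using pos[of n] A n by (simp add: field_simps)
    then have "\<bar>z n - 1 / (A * real n)\<bar> = \<bar>1 / z n - A * real n\<bar> * (z n * (1 / (A * real n)))"
      using pos[of n] A n by (simp add: abs_mult)
    also have "\<dots> \<le> ((D + E') * ln (real n)) * (4 / A * (1 / real n) * (1 / (A * real n)))"
      using dev' upper[OF that] pos[of n] A n by (intro mult_mono) auto
    also have "\<dots> = (D + E') * (4 / A\<^sup>2) * (ln (real n) / (real n)\<^sup>2)"
      by (simp add: power2_eq_square mult_ac)
    finally show ?thesis .
  qed
  moreover have "ln (real n) / (real n)\<^sup>2 \<ge> 0" if "n \<ge> M" for n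
    using that by (simp add: M_def)
  ultimately show "(\<lambda>n. z n - 1 / (A * real n)) \<in> O(\<lambda>n. ln (real n) / (real n)\<^sup>2)"
    unfolding eventually_sequentially
    by (intro bigoI[of _ "(D + E') * (4 / A\<^sup>2)"] eventually_sequentiallyI[of M])
       (metis abs_of_nonneg real_norm_def)
qed

subsection \<open>Dynamics of the recursion\<close>

text \<open>\<open>u\<close> and \<open>v\<close> model the partition functions for the boundary
  conditions \<open>1\<close> and \<open>2\<close>. Their initial values are the image of
  \<open>(1, 1)\<close> under the map, with the first simplified by \<open>total\<close>.\<close>

locale gw_recursion = gw_series +
  fixes b :: real and u v :: "nat \<Rightarrow> real"
  assumes b_gt_1: "b > 1"
    and u_0: "u 0 = 1" and v_0: "v 0 = p0 + p1 + b * S 0 1"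
    and u_Suc: "u (Suc n) = p0 + p1 * u n + S 0 (v n)"
    and v_Suc: "v (Suc n) = p0 + p1 * u n + b * S 0 (v n)"
begin

lemma v_0_gt_1: "v 0 > 1"
proof -
  have "1 * S 0 1 < b * S 0 1" using b_gt_1 S_pos[of 0 1] by (intro mult_strict_right_mono) auto
  then show ?thesis unfolding v_0 using total by linarith
qed

text \<open>The map is monotone in both coordinates, so the increase in the first step propagates;
  \<open>v n > 1\<close> keeps the orbit where \<open>S 0\<close> is strictly increasing.\<close>

lemma increasing: "u n < u (Suc n) \<and> v n < v (Suc n) \<and> v n > 1"
proof (induction n)
  case 0
  have "S 0 1 < S 0 (v 0)" using v_0_gt_1 by (intro S_strict_mono) auto
  then show ?case
    using total b_gt_1 v_0_gt_1 by (auto simp: u_Suc v_Suc u_0) (simp add: v_0)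
next
  case (Suc n)
  then have "S 0 (v n) < S 0 (v (Suc n))" by (intro S_strict_mono) auto
  moreover have "p1 * u n \<le> p1 * u (Suc n)"
    using Suc p1_nonneg by (intro mult_left_mono) auto
  moreover have "b * S 0 (v n) < b * S 0 (v (Suc n))" using calculation b_gt_1 by simp
  ultimately have "u (Suc n) < u (Suc (Suc n))" "v (Suc n) < v (Suc (Suc n))"
    unfolding u_Suc[of "Suc n"] v_Suc[of "Suc n"] unfolding u_Suc[of n] v_Suc[of n] by linarith+
  with Suc show ?case by auto
qed

lemma strict_mono_u: "strict_mono u" and strict_mono_v: "strict_mono v"
  using increasing by (auto simp: strict_mono_Suc_iff)

text \<open>If \<open>u\<close> converges, its recursion forces \<open>S 0 (v n)\<close> to
  converge, hence \<open>v\<close>. Conversely, the two coordinates at \<open>Suc n\<close> differ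
  by \<open>(b - 1) * S 0 (v n)\<close>, a continuous function of \<open>v n\<close>.\<close>

lemma convergent_u_iff_v: "convergent u \<longleftrightarrow> convergent v"
proof
  assume u: "convergent u"
  then have "convergent (\<lambda>n. u (Suc n) - p0 - p1 * u n)"
    by (intro convergent_diff convergent_mult convergent_const) (auto simp: convergent_Suc_iff)
  then have "convergent (\<lambda>n. S 0 (v n))" by (simp add: u_Suc)
  then have "convergent (\<lambda>n. p0 + p1 * u n + b * S 0 (v n))"
    using u by (intro convergent_add convergent_mult convergent_const)
  then show "convergent v" by (simp add: v_Suc[symmetric] convergent_Suc_iff)
next
  assume "convergent v"
  then obtain l where l: "v \<longlonglongrightarrow> l" by (auto simp: convergent_def)
  then have S: "(\<lambda>n. S 0 (v n)) \<longlonglongrightarrow> S 0 l" by (rule isCont_tendsto_compose[OF isCont_S])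
  have "(\<lambda>n. v (Suc n) - b * S 0 (v n) + S 0 (v n)) \<longlonglongrightarrow> l - b * S 0 l + S 0 l"
    by (intro tendsto_intros S LIMSEQ_Suc[OF l])
  moreover have "v (Suc n) - b * S 0 (v n) + S 0 (v n) = u (Suc n)" for n
    by (simp add: u_Suc v_Suc)
  ultimately have "convergent (\<lambda>n. u (Suc n))" by (auto simp: convergent_def)
  then show "convergent u" by (simp add: convergent_Suc_iff)
qed

lemma limit_is_fixpoint:
  assumes "u \<longlonglongrightarrow> U" "v \<longlonglongrightarrow> V"
  shows "U = (p0 + S 0 V) / (1 - p1)" "V = F b V" "V > 1"
proof -
  have S: "(\<lambda>n. S 0 (v n)) \<longlonglongrightarrow> S 0 V"
    using assms by (intro isCont_tendsto_compose[OF isCont_S])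
  have "(\<lambda>n. u (Suc n)) \<longlonglongrightarrow> p0 + p1 * U + S 0 V"
    unfolding u_Suc by (intro tendsto_intros S assms)
  moreover have "(\<lambda>n. v (Suc n)) \<longlonglongrightarrow> p0 + p1 * U + b * S 0 V"
    unfolding v_Suc by (intro tendsto_intros S assms)
  ultimately have "U = p0 + p1 * U + S 0 V" "V = p0 + p1 * U + b * S 0 V"
    using assms[THEN LIMSEQ_Suc] LIMSEQ_unique by blast+
  then show "U = (p0 + S 0 V) / (1 - p1)" "V = F b V" using fixpoint_iff by blast+
  have "v 0 \<le> V"
    using strict_mono_v assms(2) by (intro incseq_le) (auto intro: strict_mono_mono)
  then show "V > 1" using v_0_gt_1 by simp
qed

text \<open>For \<open>b > b_c\<close> the graph of \<open>F b\<close> lies strictly above that of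
  \<open>F b_c\<close>, hence above the diagonal, and no fixed point is left to serve as
  limit.\<close>

lemma convergent_v_imp:
  assumes "convergent v"
  shows "b \<le> b_c"
proof (rule ccontr)
  assume "\<not> b \<le> b_c"
  from assms have "convergent u" by (simp add: convergent_u_iff_v)
  with assms obtain U V where "u \<longlonglongrightarrow> U" "v \<longlonglongrightarrow> V" by (auto simp: convergent_def)
  note V = limit_is_fixpoint(2,3)[OF this]
  have "V \<le> F b_c V" using F_b_c_greater[of V] F_b_c V by (cases "V = v_c") auto
  also have "\<dots> < F b V" using V \<open>\<not> b \<le> b_c\<close> by (intro F_strict_mono) auto
  finally show False using V by simp
qed

definition u_c :: real where "u_c = (p0 + S 0 v_c) / (1 - p1)"

lemma critical_fixpoint: "u_c = p0 + p1 * u_c + S 0 v_c" "v_c = p0 + p1 * u_c + b_c * S 0 v_c"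
  using fixpoint_iff[of u_c v_c b_c] unfolding F_b_c u_c_def[symmetric] by metis+

text \<open>The critical fixed point dominates the starting values, and for
  \<open>b \<le> b_c\<close> the monotone map sends points below it to points below it.\<close>

lemma bounded_above:
  assumes "b \<le> b_c"
  shows "u n < u_c \<and> v n < v_c"
proof -
  have weak: "u n \<le> u_c \<and> v n \<le> v_c" for n
  proof (induction n)
    case 0
    have "p1 * 1 + S 0 1 \<le> p1 * 1 + S 0 v_c" using S_mono[of 1 v_c 0] v_c by simp
    then have "1 * (1 - p1) \<le> p0 + S 0 v_c" using total by simp
    then have u: "1 \<le> u_c" unfolding u_c_def using p01 by (simp add: pos_le_divide_eq)
    have "v 0 = p0 + p1 * 1 + b * S 0 1" by (simp add: v_0)
    also have "\<dots> \<le> p0 + p1 * u_c + b_c * S 0 v_c"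
      using u p1_nonneg assms S_mono[of 1 v_c 0] v_c S_nonneg[of 1 0] b_gt_1
      by (intro add_mono mult_mono) auto
    finally show ?case using u critical_fixpoint by (simp add: u_0)
  next
    case (Suc n)
    have v: "0 \<le> v n" using increasing[of n] by simp
    have pu: "p1 * u n \<le> p1 * u_c" using Suc p1_nonneg by (intro mult_left_mono) auto
    have "S 0 (v n) \<le> S 0 v_c" using Suc v by (intro S_mono) auto
    moreover from this have "b * S 0 (v n) \<le> b_c * S 0 v_c"
      using v assms b_gt_1 by (intro mult_mono S_nonneg) auto
    ultimately have "u (Suc n) \<le> p0 + p1 * u_c + S 0 v_c" "v (Suc n) \<le> p0 + p1 * u_c + b_c * S 0 v_c"
      unfolding u_Suc v_Suc using pu by linarith+
    then show ?case using critical_fixpoint by simp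
  qed
  \<comment> \<open>Strictness comes from the next, larger term; it makes the distances to the
    critical fixed point positive.\<close>
  show ?thesis using weak[of "Suc n"] increasing[of n] by linarith
qed

lemma convergent_u_v_iff: "convergent u \<longleftrightarrow> b \<le> b_c" "convergent v \<longleftrightarrow> b \<le> b_c"
proof -
  have "convergent v" if "b \<le> b_c"
  proof (rule Bseq_monoseq_convergent)
    have "norm (v n) \<le> v_c" for n using bounded_above[OF that, of n] increasing[of n] by simp
    then show "Bseq v" by (rule BseqI')
    show "monoseq v" using increasing by (auto simp: monoseq_Suc less_imp_le)
  qed
  then show "convergent v \<longleftrightarrow> b \<le> b_c" using convergent_v_imp by blast
  then show "convergent u \<longleftrightarrow> b \<le> b_c" by (simp add: convergent_u_iff_v)
qed

lemma critical_limit: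
  assumes b: "b = b_c"
  shows "u \<longlonglongrightarrow> u_c" "v \<longlonglongrightarrow> v_c"
proof -
  obtain U V where UV: "u \<longlonglongrightarrow> U" "v \<longlonglongrightarrow> V"
    using convergent_u_v_iff b by (auto simp: convergent_def)
  note fp = limit_is_fixpoint[OF UV]
  have "V = v_c" using fp F_b_c_greater[of V] b by fastforce
  with fp UV show "u \<longlonglongrightarrow> u_c" "v \<longlonglongrightarrow> v_c" by (auto simp: u_c_def)
qed

text \<open>
  At \<open>b = b_c\<close> the linearisation of the recursion at \<open>(u_c, v_c)\<close> has eigenvalues \<open>1\<close> and
  \<open>p1 * (b - 1) * S 1 v_c \<in> {0..<1}\<close>.  Below, \<open>z\<close> and \<open>w\<close> are the coordinates along the
  corresponding left eigenvectors.
\<close>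

theorem critical_asymptotics:
  assumes b: "b = b_c"
  defines "g \<equiv> S 2 v_c / 2 * ((K b)\<^sup>2 / ((b - 1) * (1 - p1)\<^sup>2 + 1))"
  shows "(\<lambda>n. (u n - u_c) - (- (1 / K b / (real n * g)))) \<in> O(\<lambda>n. ln (real n) / (real n)\<^sup>2)"
    and "(\<lambda>n. (v n - v_c) - (- (1 / (real n * g)))) \<in> O(\<lambda>n. ln (real n) / (real n)\<^sup>2)"
proof -
  define r s q where "r = S 1 v_c" and "s = S 2 v_c / 2" and "q = 1 - p1"
  define x y z w where "x = (\<lambda>n. u_c - u n)" and "y = (\<lambda>n. v_c - v n)"
    and "z = (\<lambda>n. p1 * x n + q * y n)" and "w = (\<lambda>n. q * x n - r * y n)"
  \<comment> \<open>The nonlinear remainder of the recursion, equal to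
    \<open>- s * (y n)\<^sup>2\<close> up to third order.\<close>
  define d where "d = (\<lambda>n. S 0 v_c - S 0 (v n) - r * y n)"
  \<comment> \<open>Up to sign, the determinant of the change of coordinates from
    \<open>(x, y)\<close> to \<open>(z, w)\<close>.\<close>
  define \<Delta> where "\<Delta> = q\<^sup>2 + p1 * r"
  define A where "A = K b * s * (q / \<Delta>)\<^sup>2"
  have q: "q > 0" "p1 = 1 - q" using p01 by (auto simp: q_def)
  have r: "r > 0" and s: "s > 0" unfolding r_def s_def using S_v_c_pos by auto
  \<comment> \<open>The tangency condition at \<open>v_c\<close>. Together with
    \<open>p1 + q = 1\<close> it makes \<open>z\<close> neutral in the linear part.\<close>
  have Kr: "K b * r = q" unfolding b K_b_c r_def q_def using S_v_c_pos[of 1] by simp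
  have K: "K b > 0" using Kr q r by (metis zero_less_mult_pos2)
  have K_eq: "K b = q * b + p1" by (simp add: K_def q_def)
  have \<Delta>: "\<Delta> > 0" unfolding \<Delta>_def using q(1) r p1_nonneg by (simp add: add_pos_nonneg)
  have A: "A > 0" unfolding A_def using K s q \<Delta> by simp
  have xy: "x n > 0" "y n > 0" "y n \<le> v_c" for n
    using bounded_above[of n] increasing[of n] b by (auto simp: x_def y_def)
  have z: "z n > 0" for n
    unfolding z_def using xy[of n] q(1) p1_nonneg by (simp add: add_nonneg_pos)
  have lim: "x \<longlonglongrightarrow> 0" "y \<longlonglongrightarrow> 0"
    unfolding x_def y_def using tendsto_diff[OF tendsto_const critical_limit(1)[OF b], of u_c]
      tendsto_diff[OF tendsto_const critical_limit(2)[OF b], of v_c] by auto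
  have z_lim: "z \<longlonglongrightarrow> 0"
    unfolding z_def using tendsto_add[OF tendsto_mult[OF tendsto_const[of p1] lim(1)]
      tendsto_mult[OF tendsto_const[of q] lim(2)]] by simp
  have x_Suc: "x (Suc n) = p1 * x n + r * y n + d n" for n
    using critical_fixpoint(1) by (simp add: x_def d_def u_Suc algebra_simps)
  have y_Suc: "y (Suc n) = p1 * x n + b * (r * y n + d n)" for n
    using critical_fixpoint(2) unfolding b[symmetric] by (simp add: x_def y_def d_def v_Suc algebra_simps)
  have z_Suc: "z (Suc n) = z n + K b * d n" for n
  proof -
    have "z (Suc n) = p1 * (p1 + q) * x n + (p1 + q * b) * r * y n + (p1 + q * b) * d n"
      unfolding z_def x_Suc y_Suc by (simp add: algebra_simps)
    also have "(p1 + q * b) * r = q" using Kr K_eq by (simp add: add.commute)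
    finally show ?thesis by (simp add: z_def K_eq q_def algebra_simps)
  qed
  have br: "q * (b * r) = q - r + q * r"
  proof -
    have "(q * b + (1 - q)) * r = q" using Kr unfolding K_eq by (simp add: q_def)
    then show ?thesis by (simp add: algebra_simps)
  qed
  \<comment> \<open>The second eigenvalue is the determinant \<open>p1 * (b - 1) * r\<close> of the
    linear part; by \<open>br\<close> it also equals \<open>r * b - q\<close>.\<close>
  have w_Suc: "w (Suc n) = (p1 * (b - 1) * r) * w n + (q - r * b) * d n" for n
  proof -
    have "w (Suc n) = p1 * (q - r) * x n + (q - r * b) * r * y n + (q - r * b) * d n"
      unfolding w_def x_Suc y_Suc by (simp add: algebra_simps)
    moreover have "(b - 1) * r * q = q - r" using br by (simp add: algebra_simps)
    then have "p1 * (b - 1) * r * (q * x n) = p1 * (q - r) * x n"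
      by (metis (no_types, opaque_lifting) mult.assoc mult.commute)
    moreover have "p1 * (b - 1) * r = r * b - q"
      using br unfolding q(2) by (simp add: algebra_simps)
    then have "p1 * (b - 1) * r * (r * y n) = (r * b - q) * (r * y n)"
      by (rule arg_cong)
    then have "p1 * (b - 1) * r * (r * y n) = - ((q - r * b) * r * y n)"
      by (simp add: left_diff_distrib mult.assoc)
    moreover have "p1 * (b - 1) * r * w n = p1 * (b - 1) * r * (q * x n) - p1 * (b - 1) * r * (r * y n)"
      unfolding w_def by (rule right_diff_distrib)
    ultimately show ?thesis by linarith
  qed
  have \<kappa>: "0 \<le> p1 * (b - 1) * r" "p1 * (b - 1) * r < 1"
  proof -
    show "0 \<le> p1 * (b - 1) * r" using p1_nonneg b_gt_1 r by simp
    have "(b - 1) * r * q < 1 * q" using br r by (simp add: algebra_simps)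
    then have "(b - 1) * r < 1" using q(1) by (simp del: mult_1)
    moreover have "p1 * ((b - 1) * r) \<le> 1 * ((b - 1) * r)"
      using p01 b_gt_1 r by (intro mult_right_mono) auto
    ultimately show "p1 * (b - 1) * r < 1" by (simp add: mult.assoc)
  qed
  \<comment> \<open>The constant may vanish, as \<open>p1 / \<Delta>\<close> does when
    \<open>p1 = 0\<close>.\<close>
  have cmult: "(\<lambda>n. C * f n) \<in> O(h)" if "f \<in> O(h)" for C and f h :: "nat \<Rightarrow> real"
    using that by (cases "C = 0") auto
  have yz: "y \<in> O(z)"
  proof (rule bigoI[of _ "1 / q"], intro always_eventually allI)
    show "norm (y n) \<le> 1 / q * norm (z n)" for n
      using xy[of n] z[of n] q(1) p1_nonneg by (simp add: z_def field_simps)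
  qed
  have d_Taylor: "(\<lambda>n. d n + s * (y n)\<^sup>2) \<in> O(\<lambda>n. y n ^ 3)"
  proof (rule bigoI[of _ "S 3 v_c / 6"], intro always_eventually allI)
    show "norm (d n + s * (y n)\<^sup>2) \<le> S 3 v_c / 6 * norm (y n ^ 3)" for n
      using S_Taylor2_error[of "y n" v_c] xy[of n]
      by (simp add: d_def s_def r_def y_def abs_minus_commute algebra_simps)
  qed
  have y2: "(\<lambda>n. (y n)\<^sup>2) \<in> O(\<lambda>n. (z n)\<^sup>2)" and y3: "(\<lambda>n. y n ^ 3) \<in> O(\<lambda>n. z n ^ 3)"
    using yz by (auto intro: landau_o.big_power)
  have z32: "(\<lambda>n. z n ^ 3) \<in> O(\<lambda>n. (z n)\<^sup>2)"
  proof -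
    have "eventually (\<lambda>n. z n < 1) sequentially" using z_lim by (rule order_tendstoD) simp
    then have "eventually (\<lambda>n. norm (z n ^ 3) \<le> 1 * norm ((z n)\<^sup>2)) sequentially"
      by eventually_elim (use z in \<open>auto simp: power_decreasing abs_of_pos less_imp_le\<close>)
    then show ?thesis by (rule bigoI)
  qed
  have dz3: "(\<lambda>n. d n + s * (y n)\<^sup>2) \<in> O(\<lambda>n. z n ^ 3)"
    using d_Taylor y3 by (rule landau_o.big_trans)
  have dz: "d \<in> O(\<lambda>n. (z n)\<^sup>2)"
  proof -
    have "(\<lambda>n. (d n + s * (y n)\<^sup>2) - s * (y n)\<^sup>2) \<in> O(\<lambda>n. (z n)\<^sup>2)"
      using landau_o.big_trans[OF dz3 z32]
    proof (rule sum_in_bigo(2))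
      show "(\<lambda>n. s * (y n)\<^sup>2) \<in> O(\<lambda>n. (z n)\<^sup>2)" by (rule cmult[OF y2])
    qed
    then show ?thesis by simp
  qed
  have z_slow: "(\<lambda>n. z (Suc n) - z n) \<in> O(\<lambda>n. (z n)\<^sup>2)"
    using cmult[OF dz, of "K b"] by (simp add: z_Suc)
  have "(\<lambda>n. (q - r * b) * d n) \<in> O(\<lambda>n. (z n)\<^sup>2)"
    by (rule cmult[OF dz])
  note wz = geometric_perturbation_bigo[of w, OF w_Suc \<kappa> this z z_lim z_slow]
  have y_eq: "y n = q / \<Delta> * z n - p1 / \<Delta> * w n" for n
  proof -
    have "q * z n - p1 * w n = \<Delta> * y n"
      by (simp add: z_def w_def \<Delta>_def algebra_simps power2_eq_square)
    then have "y n = (q * z n - p1 * w n) / \<Delta>" using \<Delta> by simp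
    then show ?thesis by (simp add: diff_divide_distrib)
  qed
  have x_eq: "x n = w n / q + r / q * y n" for n
    using q(1) by (simp add: w_def field_simps)
  \<comment> \<open>Difference of squares: the first factor is a multiple of \<open>w\<close>, hence
    \<open>O((z n)\<^sup>2)\<close>, and the second is \<open>O(z n)\<close>. So \<open>y\<close>
    may be replaced by \<open>q / \<Delta> * z\<close> in the quadratic term.\<close>
  have "(\<lambda>n. (y n - q / \<Delta> * z n) * (y n + q / \<Delta> * z n)) \<in> O(\<lambda>n. (z n)\<^sup>2 * z n)"
  proof (intro landau_o.big.mult sum_in_bigo(1) yz cmult)
    show "(\<lambda>n. y n - q / \<Delta> * z n) \<in> O(\<lambda>n. (z n)\<^sup>2)"
      using cmult[OF wz, of "- (p1 / \<Delta>)"] by (simp add: y_eq)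
  qed simp
  then have ysq: "(\<lambda>n. (y n)\<^sup>2 - (q / \<Delta> * z n)\<^sup>2) \<in> O(\<lambda>n. z n ^ 3)"
    by (simp add: power2_eq_square power3_eq_cube algebra_simps)
  have "(\<lambda>n. K b * (d n + s * (y n)\<^sup>2) - K b * s * ((y n)\<^sup>2 - (q / \<Delta> * z n)\<^sup>2)) \<in> O(\<lambda>n. z n ^ 3)"
  proof (rule sum_in_bigo(2))
    show "(\<lambda>n. K b * (d n + s * (y n)\<^sup>2)) \<in> O(\<lambda>n. z n ^ 3)" by (rule cmult[OF dz3])
    show "(\<lambda>n. K b * s * ((y n)\<^sup>2 - (q / \<Delta> * z n)\<^sup>2)) \<in> O(\<lambda>n. z n ^ 3)" by (rule cmult[OF ysq])
  qed
  also have "(\<lambda>n. K b * (d n + s * (y n)\<^sup>2) - K b * s * ((y n)\<^sup>2 - (q / \<Delta> * z n)\<^sup>2)) =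
      (\<lambda>n. z (Suc n) - (z n - A * (z n)\<^sup>2))"
    unfolding z_Suc A_def power_mult_distrib by (simp add: fun_eq_iff algebra_simps)
  finally have rec: "(\<lambda>n. z (Suc n) - (z n - A * (z n)\<^sup>2)) \<in> O(\<lambda>n. z n ^ 3)" .
  note z_asymp = quadratic_recursion_asymptotics[OF z z_lim A rec]
  let ?E = "\<lambda>n. ln (real n) / (real n)\<^sup>2"
  have wE: "w \<in> O(?E)"
  proof -
    have "(\<lambda>n. (z n)\<^sup>2) \<in> O(\<lambda>n. (1 / real n)\<^sup>2)"
      using z_asymp(1) by (rule landau_o.big_power)
    with wz have "w \<in> O(\<lambda>n. (1 / real n)\<^sup>2)" by (rule landau_o.big_trans)
    moreover have "(\<lambda>n. (1 / real n)\<^sup>2) \<in> O(?E)"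
    proof (rule bigoI[of _ 1], rule eventually_sequentiallyI[of 3])
      fix n :: nat assume n: "n \<ge> 3"
      have "ln (real n) \<ge> ln (exp 1)" using n exp_le by (intro ln_mono) auto
      then show "norm ((1 / real n)\<^sup>2) \<le> 1 * norm (?E n)"
        using n by (simp add: power_divide divide_right_mono)
    qed
    ultimately show ?thesis by (rule landau_o.big_trans)
  qed
  \<comment> \<open>Matches constants: \<open>z n\<close> behaves like \<open>1 / (A * n)\<close>
    and \<open>y n\<close> like \<open>q / \<Delta> * z n\<close>, which must agree with
    \<open>1 / (n * g)\<close>.\<close>
  have gA: "1 / g = q / \<Delta> / A"
  proof -
    have "K b * \<Delta> = q * ((b - 1) * q\<^sup>2 + 1)"
    proof -
      have "K b * \<Delta> = K b * q\<^sup>2 + p1 * (K b * r)" by (simp add: \<Delta>_def algebra_simps)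
      also have "\<dots> = (q * b + (1 - q)) * q\<^sup>2 + (1 - q) * q"
        unfolding Kr by (simp add: K_eq q_def)
      also have "\<dots> = q * ((b - 1) * q\<^sup>2 + 1)"
        by (simp add: algebra_simps power2_eq_square)
      finally show ?thesis .
    qed
    then have B: "(b - 1) * q\<^sup>2 + 1 = K b * \<Delta> / q" using q(1) by (simp add: field_simps)
    have "g = s * ((K b)\<^sup>2 / ((b - 1) * q\<^sup>2 + 1))" by (simp add: g_def s_def q_def)
    also have "\<dots> = s * K b * q / \<Delta>"
      unfolding B using K by (simp add: power2_eq_square)
    finally have g: "g = s * K b * q / \<Delta>" .
    show ?thesis unfolding g A_def using K s q(1) \<Delta> by (simp add: field_simps power2_eq_square)
  qed
  have yE: "(\<lambda>n. y n - 1 / (real n * g)) \<in> O(?E)"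
  proof -
    have "(\<lambda>n. q / \<Delta> * (z n - 1 / (A * real n)) - p1 / \<Delta> * w n) \<in> O(?E)"
    proof (rule sum_in_bigo(2))
      show "(\<lambda>n. q / \<Delta> * (z n - 1 / (A * real n))) \<in> O(?E)" by (rule cmult[OF z_asymp(2)])
      show "(\<lambda>n. p1 / \<Delta> * w n) \<in> O(?E)" by (rule cmult[OF wE])
    qed
    also have "(\<lambda>n. q / \<Delta> * (z n - 1 / (A * real n)) - p1 / \<Delta> * w n) = (\<lambda>n. y n - 1 / (real n * g))"
    proof
      fix n
      have "1 / (real n * g) = 1 / g * (1 / real n)" by simp
      then show "q / \<Delta> * (z n - 1 / (A * real n)) - p1 / \<Delta> * w n = y n - 1 / (real n * g)"
        unfolding gA y_eq by (simp add: algebra_simps)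
    qed
    finally show ?thesis .
  qed
  have xE: "(\<lambda>n. x n - 1 / K b / (real n * g)) \<in> O(?E)"
  proof -
    have "(\<lambda>n. 1 / q * w n + r / q * (y n - 1 / (real n * g))) \<in> O(?E)"
    proof (rule sum_in_bigo(1))
      show "(\<lambda>n. 1 / q * w n) \<in> O(?E)" by (rule cmult[OF wE])
      show "(\<lambda>n. r / q * (y n - 1 / (real n * g))) \<in> O(?E)" by (rule cmult[OF yE])
    qed
    \<comment> \<open>\<open>r / q\<close> is the ratio of \<open>x\<close> to \<open>y\<close>
      along the neutral direction \<open>w = 0\<close>; this produces the constant
      \<open>a\<close>.\<close>
    moreover have "1 / K b = r / q" using Kr K q(1) by (simp add: field_simps)
    ultimately show ?thesis by (simp add: x_eq algebra_simps)
  qed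
  have "(\<lambda>n. (u n - u_c) - (- (1 / K b / (real n * g)))) = (\<lambda>n. - 1 * (x n - 1 / K b / (real n * g)))"
    by (simp add: x_def algebra_simps)
  with cmult[OF xE, of "- 1"] show "(\<lambda>n. (u n - u_c) - (- (1 / K b / (real n * g)))) \<in> O(?E)"
    by (simp only:)
  have "(\<lambda>n. (v n - v_c) - (- (1 / (real n * g)))) = (\<lambda>n. - 1 * (y n - 1 / (real n * g)))"
    by (simp add: y_def algebra_simps)
  with cmult[OF yE, of "- 1"] show "(\<lambda>n. (v n - v_c) - (- (1 / (real n * g)))) \<in> O(?E)"
    by (simp only:)
qed

end

section \<open>From the offspring law to its power series\<close>

lemma gw_series_tail:
  fixes p :: "nat pmf"
  assumes p0: "pmf p 0 > 0"
    and nontrivial: "pmf p 0 + pmf p 1 < 1"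
    and mean: "(\<Sum>\<^sub>\<infinity>k. real k * pmf p k) < 1"
    and summable: "\<And>v::real. v \<ge> 0 \<Longrightarrow> (\<lambda>k. pmf p k * v ^ k) summable_on {2..}"
  defines "c \<equiv> \<lambda>k. if k \<ge> 2 then pmf p k else 0"
  shows "gw_series c (pmf p 0) (pmf p 1)" and "convex_series.S c 0 = tail_gf p"
proof -
  have pow: "(\<lambda>k. c k * v ^ k) summable_on UNIV" if "v \<ge> 0" for v :: real
    using summable[OF that]
    by (rule summable_on_cong_neutral[THEN iffD1, rotated -1]) (auto simp: c_def)
  \<comment> \<open>Summability at \<open>\<bar>v\<bar>\<close> extends the hypothesis on
    nonnegative arguments to the whole real line.\<close>
  have abs_summable: "summable (\<lambda>k. norm (c k * v ^ k))" for v :: real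
  proof -
    have "summable (\<lambda>k. c k * \<bar>v\<bar> ^ k)" by (intro summable_on_imp_summable pow) simp
    then show ?thesis by (simp add: abs_mult power_abs c_def)
  qed
  have pmf_sum: "(pmf p has_sum 1) UNIV"
  proof (rule sums_nonneg_imp_has_sum)
    show "pmf p sums 1"
      using sums_infsetsum_nat'[OF pmf_abs_summable, of p] infsetsum_pmf_eq_1[of p UNIV] by simp
  qed simp
  have nonlinear: "\<exists>k\<ge>2. c k > 0"
  proof (rule ccontr)
    assume "\<not> ?thesis"
    then have "pmf p k = 0" if "k \<ge> 2" for k
      using that by (metis c_def pmf_nonneg less_eq_real_def)
    then have "(pmf p has_sum (\<Sum>k\<in>{0, 1}. pmf p k)) UNIV"
      by (intro has_sum_cong_neutral[THEN iffD1, OF _ _ _ has_sum_finite]) (auto simp: not_less_eq_eq numeral_2_eq_2)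
    with pmf_sum have "1 = (\<Sum>k\<in>{0, 1}. pmf p k)" by (rule has_sum_unique)
    with nontrivial show False by simp
  qed
  interpret convex_series c
  proof
    show "summable (\<lambda>k. c k * v ^ k)" for v using abs_summable by (rule summable_norm_cancel)
  qed (use nonlinear in \<open>auto simp: c_def\<close>)
  have S_has_sum: "((\<lambda>k. c k * v ^ k) has_sum S 0 v) UNIV" for v
    unfolding S_def using summable_powers
    by (intro norm_summable_imp_has_sum abs_summable) (simp add: summable_sums)
  show S_eq: "S 0 = tail_gf p"
  proof
    fix v
    have "((\<lambda>k. pmf p k * v ^ k) has_sum S 0 v) {2..}"
      using S_has_sum[of v]
      by (rule has_sum_cong_neutral[THEN iffD1, rotated -1]) (auto simp: c_def)
    then show "S 0 v = tail_gf p v" unfolding tail_gf_def by (rule infsumI[symmetric])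
  qed
  have finite_part: "((\<lambda>k. if k \<ge> 2 then 0 else f k) has_sum f 0 + f 1) UNIV" for f :: "nat \<Rightarrow> real"
  proof -
    have "((\<lambda>k. if k \<ge> 2 then 0 else f k) has_sum (\<Sum>k\<in>{0, 1}. if k \<ge> 2 then 0 else f k)) UNIV"
      by (intro has_sum_cong_neutral[THEN iffD1, OF _ _ _ has_sum_finite]) auto
    then show ?thesis by simp
  qed
  have total: "pmf p 0 + pmf p 1 + S 0 1 = 1"
  proof (rule has_sum_unique)
    show "((\<lambda>k. (if k \<ge> 2 then 0 else pmf p k) + c k * 1 ^ k) has_sum pmf p 0 + pmf p 1 + S 0 1) UNIV"
      by (intro has_sum_add finite_part S_has_sum)
    show "((\<lambda>k. (if k \<ge> 2 then 0 else pmf p k) + c k * 1 ^ k) has_sum 1) UNIV"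
      using pmf_sum by (rule has_sum_cong[THEN iffD1, rotated]) (auto simp: c_def)
  qed
  have S1: "((\<lambda>k. real k * c k) has_sum S 1 1) UNIV"
  proof -
    \<comment> \<open>The derivative series at \<open>1\<close>, shifted by one index, is the
      contribution of \<open>k \<ge> 2\<close> to the mean; the shift adds only the zero term at
      \<open>k = 0\<close>.\<close>
    have "(\<lambda>k. diffs c k * 1 ^ k) sums S 1 1"
      using summable_sums[OF diffs_summable[of 1 1]] by (simp add: S_def)
    then have "(\<lambda>k. real (Suc k) * c (Suc k)) sums S 1 1" by (simp add: diffs_def)
    then have "(\<lambda>k. real k * c k) sums (S 1 1 + real 0 * c 0)" by (rule sums_Suc_iff[THEN iffD1])
    then show ?thesis by (intro sums_nonneg_imp_has_sum) (auto simp: c_def)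
  qed
  have subcritical: "pmf p 1 + S 1 1 < 1"
  proof -
    have "((\<lambda>k. (if k \<ge> 2 then 0 else real k * pmf p k) + real k * c k) has_sum
        (real 0 * pmf p 0 + real 1 * pmf p 1) + S 1 1) UNIV"
      by (intro has_sum_add finite_part S1)
    then have "((\<lambda>k. real k * pmf p k) has_sum (real 0 * pmf p 0 + real 1 * pmf p 1) + S 1 1) UNIV"
      by (rule has_sum_cong[THEN iffD1, rotated]) (auto simp: c_def)
    with mean show ?thesis using infsumI by fastforce
  qed
  show "gw_series c (pmf p 0) (pmf p 1)"
    by unfold_locales (use p0 total subcritical in auto)
qed

theorem theorem1:
  fixes p :: "nat pmf"
  assumes "pmf p 0 > 0"
    and "pmf p 0 + pmf p 1 < 1"
    and "(\<lambda>k. real k * pmf p k) summable_on UNIV"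
    and "(\<Sum>\<^sub>\<infinity>k. real k * pmf p k) < 1"
    and "\<And>v::real. v \<ge> 0 \<Longrightarrow> (\<lambda>k. pmf p k * v ^ k) summable_on {2..}"
  shows "(\<forall>\<beta> x. exp \<beta> > 1 \<and> x \<in> {1, 2} \<longrightarrow>
            (\<forall>n. tree_weight p \<beta> x n summable_on plane_trees n) \<and> strict_mono (\<Xi> p \<beta> x)) \<and>
         (\<exists>b\<^sub>c v\<^sub>c. b\<^sub>c > 1 \<and>
            (\<forall>b v. is_critical_pair p b v \<longleftrightarrow> b = b\<^sub>c \<and> v = v\<^sub>c) \<and>
            (\<forall>\<beta> x. exp \<beta> > 1 \<and> x \<in> {1, 2} \<longrightarrow>
               (convergent (\<Xi> p \<beta> x) \<longleftrightarrow> exp \<beta> \<le> b\<^sub>c)) \<and>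
            (\<forall>\<beta>. exp \<beta> = b\<^sub>c \<longrightarrow>
               (let a = 1 / ((b\<^sub>c - 1) * (1 - pmf p 1) + 1);
                    g\<^sub>2 = deriv (deriv (tail_gf p)) v\<^sub>c / 2 *
                         (((b\<^sub>c - 1) * (1 - pmf p 1) + 1)\<^sup>2 / ((b\<^sub>c - 1) * (1 - pmf p 1)\<^sup>2 + 1))
                in (\<lambda>n. (\<Xi> p \<beta> 1 n - lim (\<Xi> p \<beta> 1)) - (- (a / (real n * g\<^sub>2))))
                     \<in> O(\<lambda>n. ln (real n) / (real n)\<^sup>2) \<and>
                   (\<lambda>n. (\<Xi> p \<beta> 2 n - lim (\<Xi> p \<beta> 2)) - (- (1 / (real n * g\<^sub>2))))
                     \<in> O(\<lambda>n. ln (real n) / (real n)\<^sup>2))))"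
proof -
  define c where "c = (\<lambda>k. if k \<ge> 2 then pmf p k else 0)"
  interpret gw_series c "pmf p 0" "pmf p 1"
    unfolding c_def by (rule gw_series_tail(1)[OF assms(1,2,4,5)])
  have S0: "S 0 = tail_gf p" unfolding c_def by (rule gw_series_tail(2)[OF assms(1,2,4,5)])
  have deriv: "deriv (S m) = S (Suc m)" for m by (rule ext) (rule deriv_S)
  have S12: "deriv (tail_gf p) = S 1" "deriv (deriv (tail_gf p)) = S 2"
    unfolding S0[symmetric] deriv by (simp_all add: numeral_2_eq_2)
  have rec: "gw_recursion c (pmf p 0) (pmf p 1) (exp \<beta>) (\<Xi> p \<beta> 1) (\<Xi> p \<beta> 2)"
    if "exp \<beta> > 1" for \<beta>
  proof
    show "\<Xi> p \<beta> 1 0 = 1" using \<Xi>_0[OF assms(5), of \<beta> 1] total by (simp add: S0)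
  qed (use that in \<open>simp_all add: S0 \<Xi>_0[OF assms(5)] \<Xi>_Suc[OF assms(5)]\<close>)
  show ?thesis
  proof (intro conjI; (rule exI[of _ b_c], rule exI[of _ v_c], intro conjI)?; (intro conjI allI impI)?)
    fix \<beta> :: real and x :: nat assume *: "exp \<beta> > 1 \<and> x \<in> {1, 2}"
    then interpret gw_recursion c "pmf p 0" "pmf p 1" "exp \<beta>" "\<Xi> p \<beta> 1" "\<Xi> p \<beta> 2"
      by (intro rec) simp
    show "tree_weight p \<beta> x n summable_on plane_trees n" for n
      using assms(5) by (rule tree_weight_summable)
    show "strict_mono (\<Xi> p \<beta> x)" using * strict_mono_u strict_mono_v by auto
    show "convergent (\<Xi> p \<beta> x) \<longleftrightarrow> exp \<beta> \<le> b_c" using * convergent_u_v_iff by auto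
  next
    show "b_c > 1" by (rule b_c_gt_1)
  next
    fix b v
    show "is_critical_pair p b v \<longleftrightarrow> b = b_c \<and> v = v_c"
      using critical_system_iff[of v b]
      unfolding is_critical_pair_def F_def K_def S12 S0 by blast
  next
    fix \<beta> :: real assume \<beta>: "exp \<beta> = b_c"
    interpret gw_recursion c "pmf p 0" "pmf p 1" "exp \<beta>" "\<Xi> p \<beta> 1" "\<Xi> p \<beta> 2"
      using \<beta> b_c_gt_1 by (intro rec) simp
    \<comment> \<open>Identifies the bracket in the stated constants with \<open>K b_c\<close>, the
      form used in \<open>critical_asymptotics\<close>.\<close>
    have K: "(b_c - 1) * (1 - pmf p 1) + 1 = K b_c" unfolding K_def by (simp add: algebra_simps)
    show "let a = 1 / ((b_c - 1) * (1 - pmf p 1) + 1);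
            g\<^sub>2 = deriv (deriv (tail_gf p)) v_c / 2 *
                (((b_c - 1) * (1 - pmf p 1) + 1)\<^sup>2 / ((b_c - 1) * (1 - pmf p 1)\<^sup>2 + 1))
          in (\<lambda>n. (\<Xi> p \<beta> 1 n - lim (\<Xi> p \<beta> 1)) - (- (a / (real n * g\<^sub>2))))
               \<in> O(\<lambda>n. ln (real n) / (real n)\<^sup>2) \<and>
             (\<lambda>n. (\<Xi> p \<beta> 2 n - lim (\<Xi> p \<beta> 2)) - (- (1 / (real n * g\<^sub>2))))
               \<in> O(\<lambda>n. ln (real n) / (real n)\<^sup>2)"
      using critical_asymptotics[OF \<beta>] critical_limit[OF \<beta>, THEN limI]
      unfolding Let_def K S12(2) by (simp only: \<beta> simp_thms)
  qed
qed

end
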